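(* Let $G$ be an infinite finitely generated amenable group. Then there exists a $G$-effectively closed subshift (over some finite alphabet) which is not sofic.
   Context: Let $G$ be a finitely generated group and $S\subset G$ a finite generating set closed under inverses and containing $1_G$. Words in $S^*$ represent elements of $G$; write $u=_G v$ if they represent the same element. $\mathtt{WP}(G)=\{w\in S^*: w=_G 1_G\}$ is the word problem. For a finite alphabet $A$, $A^G$ has the product topology and the left shift action $(\sigma_g x)_h=x_{g^{-1}h}$. A subshift is a closed shift-invariant subset of some $A^G$. Put $[a]_g=\{x\in A^G: x_g=a\}$. A subshift $X \subset A^G$ is of finite type (SFT) if there is a finite set $\mathcal F$ of patterns (elements $p\in A^F$ with $F\subset G$ finite) such that $X=\bigcap_{p\in\mathcal F,\,g\in G}\big(A^G\setminus\bigcap_{h\in F_p}[p_h]_{gh}\big)$, where $F_p$ is the support of $p$. A subshift $Y$ is sofic if there is an SFT $Z$ on $G$ and a continuous shift-commuting surjection $Z\to Y$. A pattern coding over $A$ is a finite set $c$ of pairs $(w,a)$ with $w\in S^*$, $a\in A$. For a set $\mathcal C$ of pattern codings, $X_{\mathcal C}=\bigcap_{g\in G,\,c\in\mathcal C}\big(A^G\setminus\bigcap_{(w,a)\in c}[a]_{gw}\big)$. A subshift $X\subset A^G$ is $G$-effectively closed if $X=X_{\mathcal C}$ for some set of pattern codings $\mathcal C$ that is recursively enumerable by a Turing machine with oracle $\mathtt{WP}(G)$. $G$ is amenable if for each $\varepsilon>0$ and finite $K\subset G$ there is a non-empty finite $F\subset G$ with $|F\setminus Fk|<\varepsilon|F|$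 for all $k\in K$. *)

theory Defs
  imports "HOL-Algebra.Generated_Groups" "HOL-Analysis.Function_Topology"
begin

section \<open>Amenability and words\<close>

definition amenable :: "('g, 'm) monoid_scheme \<Rightarrow> bool" where
  "amenable G \<longleftrightarrow>
     (\<forall>\<epsilon>::real. \<epsilon> > 0 \<longrightarrow> (\<forall>K. finite K \<longrightarrow> K \<subseteq> carrier G \<longrightarrow>
        (\<exists>F. finite F \<and> F \<noteq> {} \<and> F \<subseteq> carrier G \<and>
             (\<forall>k\<in>K. real (card (F - (F #>\<^bsub>G\<^esub> k))) < \<epsilon> * real (card F)))))"

definition word_value :: "('g, 'm) monoid_scheme \<Rightarrow> 'g list \<Rightarrow> 'g" where
  "word_value G w = foldr (\<lambda>s t. s \<otimes>\<^bsub>G\<^esub> t) w \<one>\<^bsub>G\<^esub>"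

definition word_problem :: "('g, 'm) monoid_scheme \<Rightarrow> 'g set \<Rightarrow> 'g list set" where
  "word_problem G S = {w \<in> lists S. word_value G w = \<one>\<^bsub>G\<^esub>}"

section \<open>Subshifts\<close>

definition configs :: "('g, 'm) monoid_scheme \<Rightarrow> 'a set \<Rightarrow> ('g \<Rightarrow> 'a) set" where
  "configs G A = (carrier G \<rightarrow>\<^sub>E A)"

definition config_topology :: "('g, 'm) monoid_scheme \<Rightarrow> 'a set \<Rightarrow> ('g \<Rightarrow> 'a) topology" where
  "config_topology G A = product_topology (\<lambda>_. discrete_topology A) (carrier G)"

definition shift :: "('g, 'm) monoid_scheme \<Rightarrow> 'g \<Rightarrow> ('g \<Rightarrow> 'a) \<Rightarrow> ('g \<Rightarrow> 'a)" where
  "shift G g x = (\<lambda>h\<in>carrier G. x (inv\<^bsub>G\<^esub> g \<otimes>\<^bsub>G\<^esub> h))"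

definition cylinder :: "('g, 'm) monoid_scheme \<Rightarrow> 'a set \<Rightarrow> 'a \<Rightarrow> 'g \<Rightarrow> ('g \<Rightarrow> 'a) set" where
  "cylinder G A a g = {x \<in> configs G A. x g = a}"

definition subshift :: "('g, 'm) monoid_scheme \<Rightarrow> 'a set \<Rightarrow> ('g \<Rightarrow> 'a) set \<Rightarrow> bool" where
  "subshift G A X \<longleftrightarrow> finite A \<and> closedin (config_topology G A) X \<and>
     (\<forall>g\<in>carrier G. \<forall>x\<in>X. shift G g x \<in> X)"

text \<open>A pattern is a pair of its support and its values on the support. The outer intersection
  with \<^term>\<open>configs G A\<close>, here and below, is for an empty family, which defines the full shift.\<close>

definition patterns :: "('g, 'm) monoid_scheme \<Rightarrow> 'a set \<Rightarrow> ('g set \<times> ('g \<Rightarrow> 'a)) set" where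
  "patterns G A = {(F, p). finite F \<and> F \<subseteq> carrier G \<and> p \<in> F \<rightarrow>\<^sub>E A}"

definition sft :: "('g, 'm) monoid_scheme \<Rightarrow> 'a set \<Rightarrow> ('g \<Rightarrow> 'a) set \<Rightarrow> bool" where
  "sft G A X \<longleftrightarrow> subshift G A X \<and>
     (\<exists>P. finite P \<and> P \<subseteq> patterns G A \<and>
        X = configs G A \<inter>
            (\<Inter>(F, p)\<in>P. \<Inter>g\<in>carrier G.
               configs G A - (\<Inter>h\<in>F. cylinder G A (p h) (g \<otimes>\<^bsub>G\<^esub> h))))"

text \<open>The alphabet of the covering SFT ranges over finite sets of naturals; up to renaming of
  letters these are all finite alphabets.\<close>

definition sofic :: "('g, 'm) monoid_scheme \<Rightarrow> 'a set \<Rightarrow> ('g \<Rightarrow> 'a) set \<Rightarrow> bool" where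
  "sofic G A Y \<longleftrightarrow> subshift G A Y \<and>
     (\<exists>(B :: nat set) Z \<phi>. sft G B Z \<and>
        continuous_map (subtopology (config_topology G B) Z)
                       (subtopology (config_topology G A) Y) \<phi> \<and>
        \<phi> ` Z = Y \<and>
        (\<forall>g\<in>carrier G. \<forall>z\<in>Z. \<phi> (shift G g z) = shift G g (\<phi> z)))"

section \<open>Turing machines with an oracle\<close>

text \<open>Deterministic machines with finitely many two-way infinite tapes. Tape 0 initially holds
  the input; tape 1 is the query tape. The component \<open>transition\<close> is only meaningful on the
  (finite) sets of states and of tuples of tape symbols; the states and the work symbols are
  taken from the naturals without loss of generality.\<close>

datatype 'i cell = Blank | Input 'i | Work nat

datatype dir = Left | Stay | Right

record 'i oracle_tm =
  tape_num :: nat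
  tm_states :: "nat set"
  tm_symbols :: "'i cell set"
  start_state :: nat
  accept_state :: nat
  query_state :: nat
  yes_state :: nat
  no_state :: nat
  transition :: "nat \<Rightarrow> 'i cell list \<Rightarrow> nat \<times> ('i cell \<times> dir) list"

definition wf_oracle_tm :: "'i set \<Rightarrow> 'i oracle_tm \<Rightarrow> bool" where
  "wf_oracle_tm \<Sigma> M \<longleftrightarrow>
     tape_num M \<ge> 2 \<and>
     finite (tm_states M) \<and> finite (tm_symbols M) \<and>
     {start_state M, accept_state M, query_state M, yes_state M, no_state M} \<subseteq> tm_states M \<and>
     Blank \<in> tm_symbols M \<and> Input ` \<Sigma> \<subseteq> tm_symbols M \<and>
     (\<forall>q\<in>tm_states M. \<forall>v\<in>lists (tm_symbols M). length v = tape_num M \<longrightarrow>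
        fst (transition M q v) \<in> tm_states M \<and>
        length (snd (transition M q v)) = tape_num M \<and>
        snd (transition M q v) \<in> lists (tm_symbols M \<times> UNIV))"

text \<open>A tape is a head position together with the contents of the cells.\<close>

type_synonym 'i tape = "int \<times> (int \<Rightarrow> 'i cell)"

fun scanned :: "'i tape \<Rightarrow> 'i cell" where
  "scanned (h, t) = t h"

fun offset :: "dir \<Rightarrow> int" where
  "offset Left = - 1"
| "offset Stay = 0"
| "offset Right = 1"

fun act :: "'i cell \<times> dir \<Rightarrow> 'i tape \<Rightarrow> 'i tape" where
  "act (s, d) (h, t) = (h + offset d, t(h := s))"

text \<open>The word being queried starts at the head of the query tape and ends before the first
  blank cell.\<close>

fun holds_word :: "'i tape \<Rightarrow> 'i list \<Rightarrow> bool" where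
  "holds_word (h, t) w \<longleftrightarrow>
     (\<forall>i<length w. t (h + int i) = Input (w ! i)) \<and> t (h + int (length w)) = Blank"

fun tm_step :: "'i list set \<Rightarrow> 'i oracle_tm \<Rightarrow> nat \<times> 'i tape list \<Rightarrow> nat \<times> 'i tape list" where
  "tm_step Orc M (q, ts) =
     (if q = query_state M
      then (if \<exists>w\<in>Orc. holds_word (ts ! 1) w then yes_state M else no_state M, ts)
      else (fst (transition M q (map scanned ts)),
            map2 act (snd (transition M q (map scanned ts))) ts))"

definition input_tape :: "'i list \<Rightarrow> 'i tape" where
  "input_tape w =
     (0, \<lambda>i. if 0 \<le> i \<and> i < int (length w) then Input (w ! nat i) else Blank)"

definition tm_init :: "'i oracle_tm \<Rightarrow> 'i list \<Rightarrow> nat \<times> 'i tape list" where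
  "tm_init M w = (start_state M, input_tape w # replicate (tape_num M - 1) (0, \<lambda>_. Blank))"

definition tm_accepts :: "'i list set \<Rightarrow> 'i oracle_tm \<Rightarrow> 'i list \<Rightarrow> bool" where
  "tm_accepts Orc M w \<longleftrightarrow> (\<exists>n. fst ((tm_step Orc M ^^ n) (tm_init M w)) = accept_state M)"

definition re_with_oracle :: "'i set \<Rightarrow> 'i list set \<Rightarrow> 'i list set \<Rightarrow> bool" where
  "re_with_oracle \<Sigma> Orc L \<longleftrightarrow>
     (\<exists>M. wf_oracle_tm \<Sigma> M \<and> L = {w \<in> lists \<Sigma>. tm_accepts Orc M w})"

section \<open>Effectively closed subshifts\<close>

type_synonym ('g, 'a) pattern_coding = "('g list \<times> 'a) set"

definition pattern_codings :: "'g set \<Rightarrow> 'a set \<Rightarrow> ('g, 'a) pattern_coding set" where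
  "pattern_codings S A = {c. finite c \<and> c \<subseteq> lists S \<times> A}"

definition coding_subshift ::
  "('g, 'm) monoid_scheme \<Rightarrow> 'a set \<Rightarrow> ('g, 'a) pattern_coding set \<Rightarrow> ('g \<Rightarrow> 'a) set" where
  "coding_subshift G A C =
     configs G A \<inter>
     (\<Inter>g\<in>carrier G. \<Inter>c\<in>C.
        configs G A - (\<Inter>(w, a)\<in>c. cylinder G A a (g \<otimes>\<^bsub>G\<^esub> word_value G w)))"

text \<open>Pattern codings are given to a machine as words over the disjoint union of \<open>S\<close> and the
  alphabet, by listing their elements; the letter ending a pair serves as separator. A coding is
  represented by all of its listings (in any order, possibly with repetitions).\<close>

definition encode_listing :: "('g list \<times> 'a) list \<Rightarrow> ('g + 'a) list" where
  "encode_listing l = concat (map (\<lambda>(w, a). map Inl w @ [Inr a]) l)"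

definition coding_language :: "('g, 'a) pattern_coding set \<Rightarrow> ('g + 'a) list set" where
  "coding_language C = {encode_listing l |l. set l \<in> C}"

definition effectively_closed ::
  "('g, 'm) monoid_scheme \<Rightarrow> 'g set \<Rightarrow> 'a set \<Rightarrow> ('g \<Rightarrow> 'a) set \<Rightarrow> bool" where
  "effectively_closed G S A X \<longleftrightarrow> subshift G A X \<and>
     (\<exists>C \<subseteq> pattern_codings S A.
        re_with_oracle (S <+> A) (map Inl ` word_problem G S) (coding_language C) \<and>
        X = coding_subshift G A C)"

end

theory Submission
  imports Defs
begin

text \<open>Consider configurations over \<open>{0, 1, 2, 3, 4}\<close> in which, for no group elements \<open>g\<close>, \<open>t\<close>, \<open>h\<close>, the
  labels 1, 2, 3, 4 occur at \<open>g\<close>, \<open>gt\<close>, \<open>gh\<close>, \<open>gth\<close> respectively. So two markers 1 and 2, which may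
  be arbitrarily far apart, make the surroundings of the second one mimic those of the first one:
  a 3 here excludes a 4 at the corresponding position there. This mimic shift is effectively closed
  but not sofic.

  It is not sofic because a shift of finite type that covers it would have to carry too much
  information across the boundary of a finite set. Let \<open>F\<close> be a finite set and \<open>\<tau>F\<close> a disjoint
  translate; it exists since the group is infinite. Write a set \<open>P\<close> with 3s on \<open>F\<close>, the complement of
  \<open>P\<close> with 4s on \<open>\<tau>F\<close>, and add markers. This gives \<open>2 ^ card F\<close> configurations, up to boundary effects.
  The factor map has a finite window (\<open>factor_map_local\<close>), and two points of the covering shift
  that agree on a boundary layer of \<open>F\<close> can be exchanged inside \<open>F\<close> (\<open>sft_splice\<close>). By amenability
  the layer can be taken so thin that it has fewer than \<open>2 ^ card F\<close> fillings
  (\<open>amenable_small_window_boundary\<close>). So two sets \<open>P\<close> can be interchanged while \<open>\<tau>F\<close> stays as it is,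
  which breaks the mimic rule (\<open>mimic_shift_not_sofic\<close>).

  It is effectively closed because the forbidden patterns are spelled by pairs of words \<open>v\<close>, \<open>w\<close> over
  the generators, for \<open>t\<close> and \<open>h\<close>. A machine has to recognise all listings of the coding with entries
  \<open>(\<one>, 1)\<close>, \<open>(v, 2)\<close>, \<open>(w, 3)\<close>, \<open>(vw, 4)\<close>, in any order and with repetitions. The four group elements are
  therefore spelled by words of equal length from which \<open>v\<close> and \<open>w\<close> can be read off; the parts that
  should not contribute are cancelled letter by letter. Then it is enough to compare each entry with
  its neighbour, which a finite control with two heads does in a single sweep (\<open>reads_iff\<close>,
  \<open>re_trailing_language\<close>).\<close>

section \<open>Languages recognised with a trailing head\<close>

text \<open>A deterministic finite control reads a word with two heads. The leading head consumes one letter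
of the first list in every step; the trailing head, on the second list, either follows or waits.
In the end the control decides from its state and the letter under the trailing head, so a
trailing head that has run off its list means rejection.\<close>

fun trailing_accepts ::
  "('q \<Rightarrow> 'i \<Rightarrow> 'i \<Rightarrow> ('q \<times> bool) option) \<Rightarrow> ('q \<Rightarrow> 'i \<Rightarrow> bool) \<Rightarrow> 'q \<Rightarrow> 'i list \<Rightarrow> 'i list \<Rightarrow> bool"
where
  "trailing_accepts \<delta> fin q xs [] = False"
| "trailing_accepts \<delta> fin q [] (y # ys) = fin q y"
| "trailing_accepts \<delta> fin q (x # xs) (y # ys) =
     (case \<delta> q x y of None \<Rightarrow> False
      | Some (q', b) \<Rightarrow> trailing_accepts \<delta> fin q' xs (if b then ys else y # ys))"

text \<open>A machine simulates such a control by copying the input to the second tape. After that both heads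
stand at the right end, so the simulation sweeps to the left and the control sees the word
reversed.\<close>

datatype 'q phase = Copy | Sweep 'q | Accept | Halt | Query

fun sweep_trans ::
  "('q \<Rightarrow> 'i \<Rightarrow> 'i \<Rightarrow> ('q \<times> bool) option) \<Rightarrow> ('q \<Rightarrow> 'i \<Rightarrow> bool) \<Rightarrow> 'q \<Rightarrow>
   'q phase \<Rightarrow> 'i cell \<Rightarrow> 'i cell \<Rightarrow> 'q phase \<times> ('i cell \<times> dir) list"
where
  "sweep_trans \<delta> fin q0 Copy (Input x) c = (Copy, [(Input x, Right), (Input x, Right)])"
| "sweep_trans \<delta> fin q0 Copy Blank c = (Sweep q0, [(Blank, Left), (Blank, Left)])"
| "sweep_trans \<delta> fin q0 (Sweep q) (Input x) (Input y) =
     (case \<delta> q x y of None \<Rightarrow> (Halt, [(Input x, Stay), (Input y, Stay)])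
      | Some (q', b) \<Rightarrow> (Sweep q', [(Input x, Left), (Input y, if b then Left else Stay)]))"
| "sweep_trans \<delta> fin q0 (Sweep q) Blank (Input y) =
     (if fin q y then Accept else Halt, [(Blank, Stay), (Input y, Stay)])"
| "sweep_trans \<delta> fin q0 p c d = (Halt, [(c, Stay), (d, Stay)])"

definition sweep_tm ::
  "'i set \<Rightarrow> 'q set \<Rightarrow> ('q phase \<Rightarrow> nat) \<Rightarrow>
   ('q \<Rightarrow> 'i \<Rightarrow> 'i \<Rightarrow> ('q \<times> bool) option) \<Rightarrow> ('q \<Rightarrow> 'i \<Rightarrow> bool) \<Rightarrow> 'q \<Rightarrow> 'i oracle_tm"
where
  "sweep_tm \<Sigma> Q code \<delta> fin q0 =
     \<comment> \<open>The copy goes to the query tape. This is harmless, since no transition enters \<^term>\<open>Query\<close>.\<close>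
     (let P = {Copy, Accept, Halt, Query} \<union> Sweep ` Q in
      \<lparr>tape_num = 2, tm_states = code ` P, tm_symbols = insert Blank (Input ` \<Sigma>),
       start_state = code Copy, accept_state = code Accept, query_state = code Query,
       yes_state = code Halt, no_state = code Halt,
       transition = (\<lambda>n v. map_prod code id
         (sweep_trans \<delta> fin q0 (inv_into P code n) (v ! 0) (v ! 1)))\<rparr>)"

declare tm_step.simps [simp del]

text \<open>Acceptance from an arbitrary configuration can be pushed through one step at a time
(\<open>accepts_from_unfold\<close>), so the two phases of the machine are verified by plain inductions
without counting steps.\<close>

definition accepts_from :: "'i list set \<Rightarrow> 'i oracle_tm \<Rightarrow> nat \<times> 'i tape list \<Rightarrow> bool" where
  "accepts_from Orc M c \<longleftrightarrow> (\<exists>n. fst ((tm_step Orc M ^^ n) c) = accept_state M)"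

lemma accepts_from_unfold:
  "accepts_from Orc M c \<longleftrightarrow> fst c = accept_state M \<or> accepts_from Orc M (tm_step Orc M c)"
proof
  assume "accepts_from Orc M c"
  then obtain n where n: "fst ((tm_step Orc M ^^ n) c) = accept_state M"
    by (auto simp: accepts_from_def)
  show "fst c = accept_state M \<or> accepts_from Orc M (tm_step Orc M c)"
  proof (cases n)
    case (Suc k)
    then show ?thesis
      using n by (auto simp: accepts_from_def funpow_Suc_right simp del: funpow.simps)
  qed (use n in simp)
next
  assume *: "fst c = accept_state M \<or> accepts_from Orc M (tm_step Orc M c)"
  then show "accepts_from Orc M c"
  proof
    assume "fst c = accept_state M"
    then have "fst ((tm_step Orc M ^^ 0) c) = accept_state M" by simp
    then show ?thesis unfolding accepts_from_def by blast
  next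
    assume "accepts_from Orc M (tm_step Orc M c)"
    then obtain n where "fst ((tm_step Orc M ^^ n) (tm_step Orc M c)) = accept_state M"
      by (auto simp: accepts_from_def)
    then have "fst ((tm_step Orc M ^^ Suc n) c) = accept_state M"
      by (simp add: funpow_Suc_right del: funpow.simps)
    then show ?thesis unfolding accepts_from_def by blast
  qed
qed

definition content :: "'i list \<Rightarrow> int \<Rightarrow> 'i cell" where
  "content w i = (if 0 \<le> i \<and> i < int (length w) then Input (w ! nat i) else Blank)"

context
  fixes \<Sigma> :: "'i set" and Q :: "'q set" and code :: "'q phase \<Rightarrow> nat"
    and \<delta> :: "'q \<Rightarrow> 'i \<Rightarrow> 'i \<Rightarrow> ('q \<times> bool) option" and fin :: "'q \<Rightarrow> 'i \<Rightarrow> bool" and q0 :: 'q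
    and Orc :: "'i list set"
  assumes q0: "q0 \<in> Q"
    and closed: "\<And>q x y q' b. \<lbrakk>q \<in> Q; x \<in> \<Sigma>; y \<in> \<Sigma>; \<delta> q x y = Some (q', b)\<rbrakk> \<Longrightarrow> q' \<in> Q"
    and inj: "inj_on code ({Copy, Accept, Halt, Query} \<union> Sweep ` Q)"
begin

abbreviation (input) "M \<equiv> sweep_tm \<Sigma> Q code \<delta> fin q0"

lemma code_eq_iff:
  assumes "p \<in> {Copy, Accept, Halt, Query} \<union> Sweep ` Q" "p' \<in> {Copy, Accept, Halt, Query} \<union> Sweep ` Q"
  shows "code p = code p' \<longleftrightarrow> p = p'"
  using inj_on_eq_iff[OF inj assms] .

lemma step_sweep_tm:
  assumes "p \<in> {Copy, Accept, Halt} \<union> Sweep ` Q"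
  shows "tm_step Orc M (code p, [(i, t), (j, u)]) =
    (let (p', as) = sweep_trans \<delta> fin q0 p (t i) (u j) in (code p', map2 act as [(i, t), (j, u)]))"
proof -
  have "code p \<noteq> code Query"
    using assms code_eq_iff[of p Query] by auto
  moreover have "inv_into ({Copy, Accept, Halt, Query} \<union> Sweep ` Q) code (code p) = p"
    using assms by (intro inv_into_f_f[OF inj]) auto
  ultimately show ?thesis
    by (simp add: tm_step.simps sweep_tm_def Let_def case_prod_unfold)
qed

lemma Halt_rejects: "\<not> accepts_from Orc M (code Halt, [(i, t), (j, u)])"
proof -
  have eq: "tm_step Orc M (code Halt, [(i, t), (j, u)]) = (code Halt, [(i, t), (j, u)])" for i t j u
    by (simp add: step_sweep_tm fun_upd_idem)
  have "(tm_step Orc M ^^ n) (code Halt, [(i, t), (j, u)]) = (code Halt, [(i, t), (j, u)])" for n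
    by (induction n) (simp_all add: eq)
  moreover have "code Halt \<noteq> accept_state M"
    using code_eq_iff[of Halt Accept] by (simp add: sweep_tm_def Let_def)
  ultimately show ?thesis
    by (simp add: accepts_from_def)
qed

lemma accepts_from_step:
  assumes "p \<in> {Copy} \<union> Sweep ` Q"
  shows "accepts_from Orc M (code p, [(i, t), (j, u)]) \<longleftrightarrow>
    accepts_from Orc M (let (p', as) = sweep_trans \<delta> fin q0 p (t i) (u j)
                        in (code p', map2 act as [(i, t), (j, u)]))"
proof -
  have "code p \<noteq> code Accept"
    using assms code_eq_iff[of p Accept] by auto
  then show ?thesis
    using assms by (subst accepts_from_unfold, subst step_sweep_tm) (auto simp: sweep_tm_def Let_def)
qed

lemma accepts_from_Accept: "accepts_from Orc M (code Accept, ts)"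
  by (subst accepts_from_unfold) (simp add: sweep_tm_def Let_def)

text \<open>The leading head is about to read the \<open>k\<close>-th letter and the trailing head the \<open>m\<close>-th one,
counted from 1; what they still have in front of them are the reversed prefixes of these lengths.\<close>

lemma sweep_phase:
  assumes "set w \<subseteq> \<Sigma>" "q \<in> Q" "k \<le> m" "m \<le> length w"
  shows "accepts_from Orc M (code (Sweep q), [(int k - 1, content w), (int m - 1, content w)]) \<longleftrightarrow>
    trailing_accepts \<delta> fin q (rev (take k w)) (rev (take m w))"
  using assms
proof (induction k arbitrary: q m)
  case 0
  show ?case
  proof (cases m)
    case 0
    then show ?thesis
      using "0.prems" by (simp add: accepts_from_step content_def Halt_rejects)
  next
    case (Suc m')
    then show ?thesis
      using "0.prems"
      by (simp add: accepts_from_step content_def Halt_rejects accepts_from_Accept take_Suc_conv_app_nth)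
  qed
next
  case (Suc k)
  then obtain m' where m: "m = Suc m'"
    by (cases m) auto
  have len: "k < length w" "m' < length w" "k \<le> m'"
    using Suc.prems m by auto
  have mem: "w ! k \<in> \<Sigma>" "w ! m' \<in> \<Sigma>"
    using Suc.prems(1) len by (auto simp: subset_iff)
  have cells: "content w (int k) = Input (w ! k)" "content w (int m') = Input (w ! m')"
    using len by (auto simp: content_def)
  show ?case
  proof (cases "\<delta> q (w ! k) (w ! m')")
    case None
    then show ?thesis
      using Suc.prems len
      by (simp add: m accepts_from_step cells Halt_rejects take_Suc_conv_app_nth)
  next
    case (Some r)
    obtain q' b where r: "r = (q', b)" by (cases r)
    have "q' \<in> Q"
      using closed[OF Suc.prems(2) mem] Some r by simp
    then have IH: "accepts_from Orc M (code (Sweep q'), [(int k - 1, content w), (int n - 1, content w)]) \<longleftrightarrow>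
        trailing_accepts \<delta> fin q' (rev (take k w)) (rev (take n w))" if "k \<le> n" "n \<le> length w" for n
      using Suc.IH[OF Suc.prems(1)] that by blast
    have upd: "(content w)(int i := Input (w ! i)) = content w" if "i < length w" for i
      using that by (auto simp: content_def)
    show ?thesis
      using Suc.prems len IH[of m'] IH[of "Suc m'"]
      by (cases b) (simp_all add: m accepts_from_step cells Some r upd take_Suc_conv_app_nth algebra_simps)
  qed
qed

lemma copy_phase:
  assumes "set w \<subseteq> \<Sigma>" "k \<le> length w"
  shows "accepts_from Orc M (code Copy, [(int k, content w), (int k, content (take k w))]) \<longleftrightarrow>
    trailing_accepts \<delta> fin q0 (rev w) (rev w)"
  using assms(2)
proof (induction rule: inc_induct)
  case base
  have "(content w)(int (length w) := Blank) = content w"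
    by (auto simp: content_def)
  then show ?case
    using sweep_phase[OF assms(1) q0, of "length w" "length w"]
    by (simp add: accepts_from_step content_def[of w "int (length w)"])
next
  case (step k)
  have "(content w)(int k := Input (w ! k)) = content w"
    using step by (auto simp: content_def)
  moreover have "(content (take k w))(int k := Input (w ! k)) = content (take (Suc k) w)"
    using step by (auto simp: content_def fun_eq_iff min_def nth_append take_Suc_conv_app_nth)
  ultimately show ?case
    using step by (simp add: accepts_from_step content_def[of w "int k"] add.commute)
qed

lemma tm_accepts_sweep_tm:
  assumes "set w \<subseteq> \<Sigma>"
  shows "tm_accepts Orc M w \<longleftrightarrow> trailing_accepts \<delta> fin q0 (rev w) (rev w)"
proof -
  have "tm_init M w = (code Copy, [(int 0, content w), (int 0, content (take 0 w))])"
    by (auto simp: tm_init_def sweep_tm_def Let_def input_tape_def content_def fun_eq_iff)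
  then show ?thesis
    using copy_phase[OF assms, of 0] by (simp add: tm_accepts_def accepts_from_def)
qed

lemma wf_sweep_tm:
  assumes "finite \<Sigma>" "finite Q"
  shows "wf_oracle_tm \<Sigma> M"
proof -
  let ?P = "{Copy, Accept, Halt, Query} \<union> Sweep ` Q" and ?T = "insert Blank (Input ` \<Sigma>)"
  have step: "fst (sweep_trans \<delta> fin q0 p c d) \<in> ?P \<and>
      length (snd (sweep_trans \<delta> fin q0 p c d)) = 2 \<and>
      snd (sweep_trans \<delta> fin q0 p c d) \<in> lists (?T \<times> UNIV)"
    if "p \<in> ?P" "c \<in> ?T" "d \<in> ?T" for p c d
    using that closed q0
    by (cases "(\<delta>, fin, q0, p, c, d)" rule: sweep_trans.cases) (auto split: option.split)
  have "\<forall>n \<in> code ` ?P. \<forall>v \<in> lists ?T. length v = 2 \<longrightarrow>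
      (let r = sweep_trans \<delta> fin q0 (inv_into ?P code n) (v ! 0) (v ! 1) in
       code (fst r) \<in> code ` ?P \<and> length (snd r) = 2 \<and> snd r \<in> lists (?T \<times> UNIV))"
  proof (intro ballI impI)
    fix n v
    assume n: "n \<in> code ` ?P" and v: "v \<in> lists ?T" "length v = 2"
    have "inv_into ?P code n \<in> ?P" using n by (rule inv_into_into)
    moreover have "v ! 0 \<in> ?T" "v ! 1 \<in> ?T"
      using v nth_mem[of 0 v] nth_mem[of 1 v] by (metis in_lists_conv_set numeral_2_eq_2 lessI zero_less_Suc One_nat_def)+
    ultimately show "let r = sweep_trans \<delta> fin q0 (inv_into ?P code n) (v ! 0) (v ! 1) in
       code (fst r) \<in> code ` ?P \<and> length (snd r) = 2 \<and> snd r \<in> lists (?T \<times> UNIV)"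
      using step[of "inv_into ?P code n" "v ! 0" "v ! 1"] unfolding Let_def by blast
  qed
  then show ?thesis
    using assms unfolding wf_oracle_tm_def sweep_tm_def Let_def by (simp del: Un_insert_left add: subset_insertI)
qed

end

text \<open>The two-head controls are thus a convenient programming model: to show recursive enumerability it
suffices to give a control with finitely many states.\<close>

lemma re_trailing_language:
  fixes \<Sigma> :: "'i set"
  assumes "finite \<Sigma>" "finite Q" "q0 \<in> Q"
    and "\<And>q x y q' b. \<lbrakk>q \<in> Q; x \<in> \<Sigma>; y \<in> \<Sigma>; \<delta> q x y = Some (q', b)\<rbrakk> \<Longrightarrow> q' \<in> Q"
  shows "re_with_oracle \<Sigma> Orc {w \<in> lists \<Sigma>. trailing_accepts \<delta> fin q0 (rev w) (rev w)}"
proof -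
  obtain code where "inj_on (code :: _ \<Rightarrow> nat) ({Copy, Accept, Halt, Query} \<union> Sweep ` Q)"
    using finite_imp_inj_to_nat_seg[of "{Copy, Accept, Halt, Query} \<union> Sweep ` Q"] assms(2) by auto
  note sweep = assms(3,4) this
  have "wf_oracle_tm \<Sigma> (sweep_tm \<Sigma> Q code \<delta> fin q0)"
    by (rule wf_sweep_tm[OF sweep assms(1,2)])
  moreover have "{w \<in> lists \<Sigma>. trailing_accepts \<delta> fin q0 (rev w) (rev w)} =
      {w \<in> lists \<Sigma>. tm_accepts Orc (sweep_tm \<Sigma> Q code \<delta> fin q0) w}"
  proof (intro Collect_cong conj_cong refl)
    fix w :: "'i list"
    assume "w \<in> lists \<Sigma>"
    then have "set w \<subseteq> \<Sigma>" by (auto simp: in_lists_conv_set)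
    thm tm_accepts_sweep_tm[OF sweep, symmetric]
    then show "trailing_accepts \<delta> fin q0 (rev w) (rev w) \<longleftrightarrow>
        tm_accepts Orc (sweep_tm \<Sigma> Q code \<delta> fin q0) w"
      by (subst tm_accepts_sweep_tm[OF sweep]) (assumption | rule refl)+
  qed
  ultimately show ?thesis
    unfolding re_with_oracle_def by blast
qed

section \<open>Codings whose entries repeat their parameters\<close>

text \<open>Let \<open>v\<close> and \<open>w\<close> be words over \<open>S - {\<one>}\<close>. The four positions \<open>\<one>\<close>, \<open>v\<close>, \<open>w\<close>, \<open>vw\<close> of a forbidden
pattern are spelled by words that all contain \<open>v\<close> and \<open>w\<close> in full: each letter \<open>s\<close> is preceded by
\<open>\<one>\<close> if it is to contribute to the group element, and by \<open>inv s\<close> if it is to be cancelled. A single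
letter \<open>\<one>\<close> separates the two parts. The four words have the same length and differ only in the
padding, so two entries of a listing belong to the same coding exactly if they match outside the
padding. This relation is transitive, hence comparing neighbouring entries checks a listing in any
order and with any repetitions.\<close>

definition padding :: "('g, 'm) monoid_scheme \<Rightarrow> bool \<Rightarrow> 'g \<Rightarrow> 'g" where
  "padding G keep s = (if keep then \<one>\<^bsub>G\<^esub> else inv\<^bsub>G\<^esub> s)"

definition keeps_first :: "nat \<Rightarrow> bool" where "keeps_first a \<longleftrightarrow> a \<in> {2, 4}"
definition keeps_second :: "nat \<Rightarrow> bool" where "keeps_second a \<longleftrightarrow> a \<in> {3, 4}"

fun padded :: "('g, 'm) monoid_scheme \<Rightarrow> bool \<Rightarrow> 'g list \<Rightarrow> 'g list" where
  "padded G keep [] = []"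
| "padded G keep (s # u) = padding G keep s # s # padded G keep u"

definition position_word :: "('g, 'm) monoid_scheme \<Rightarrow> 'g list \<Rightarrow> 'g list \<Rightarrow> nat \<Rightarrow> 'g list" where
  "position_word G v w a = padded G (keeps_first a) v @ \<one>\<^bsub>G\<^esub> # padded G (keeps_second a) w"

definition mimic_coding :: "('g, 'm) monoid_scheme \<Rightarrow> 'g list \<Rightarrow> 'g list \<Rightarrow> ('g, nat) pattern_coding" where
  "mimic_coding G v w = (\<lambda>a. (position_word G v w a, a)) ` {1..4}"

definition mimic_codings :: "('g, 'm) monoid_scheme \<Rightarrow> 'g set \<Rightarrow> ('g, nat) pattern_coding set" where
  "mimic_codings G S = {mimic_coding G v w | v w. v \<in> lists (S - {\<one>\<^bsub>G\<^esub>}) \<and> w \<in> lists (S - {\<one>\<^bsub>G\<^esub>})}"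

text \<open>The same spelling as the control meets it, from right to left: a letter comes before its padding,
and the label of an entry comes before its word.\<close>

fun backward :: "('g, 'm) monoid_scheme \<Rightarrow> bool \<Rightarrow> 'g list \<Rightarrow> ('g + nat) list" where
  "backward G keep [] = []"
| "backward G keep (s # u) = Inl s # Inl (padding G keep s) # backward G keep u"

lemma backward_append: "backward G keep (u @ w) = backward G keep u @ backward G keep w"
  by (induction u) auto

lemma rev_padded: "rev (map Inl (padded G keep u)) = backward G keep (rev u)"
  by (induction u) (auto simp: backward_append)

definition backward_tail :: "('g, 'm) monoid_scheme \<Rightarrow> 'g list \<Rightarrow> 'g list \<Rightarrow> nat \<Rightarrow> ('g + nat) list" where
  "backward_tail G v w a = backward G (keeps_second a) w @ Inl \<one>\<^bsub>G\<^esub> # backward G (keeps_first a) v"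

lemma rev_encode_listing:
  "rev (encode_listing (map (\<lambda>a. (position_word G v w a, a)) as)) =
   concat (map (\<lambda>a. Inr a # backward_tail G (rev v) (rev w) a) (rev as))"
  by (induction as)
    (auto simp: encode_listing_def position_word_def backward_tail_def rev_padded[symmetric] rev_map)

text \<open>The states of the control. In \<open>Key first seen a sep\<close> it reads an entry labelled \<open>a\<close> and expects
a letter of \<open>v\<close> or \<open>w\<close>, the separator, or the label of the next entry; \<open>sep\<close> tells that the separator
has been passed, \<open>seen\<close> collects the labels met so far, and \<open>first\<close> holds in the entry that is read
first, which has no predecessor to be compared with. In \<open>Pad first seen a sep s\<close> it expects the
padding of the letter \<open>s\<close>. During the first entry the trailing head waits at that entry's label;
from then on it is exactly one entry behind. Since the padding of the entry under the trailing head
was checked when the leading head was there, only the letters of \<open>v\<close> and \<open>w\<close>, the separators and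
the ends of entries are compared.\<close>

datatype 'g reader =
  Start
| Key bool "nat set" nat bool
| Pad bool "nat set" nat bool 'g

fun read_step :: "('g, 'm) monoid_scheme \<Rightarrow> 'g reader \<Rightarrow> 'g + nat \<Rightarrow> 'g + nat \<Rightarrow> ('g reader \<times> bool) option" where
  "read_step G Start x y =
     (case x of Inr a \<Rightarrow> if a \<in> {1..4} then Some (Key True {a} a False, False) else None
      | Inl s \<Rightarrow> None)"
| "read_step G (Key first seen a sep) x y =
     (case x of
        Inr b \<Rightarrow> if sep \<and> b \<in> {1..4} \<and> (\<exists>c. y = Inr c)
                 then Some (Key False (insert b seen) b False, True) else None
      | Inl s \<Rightarrow> if first \<or> y = Inl s
                 then if s = \<one>\<^bsub>G\<^esub>
                      then if sep then None else Some (Key first seen a True, \<not> first)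
                      else Some (Pad first seen a sep s, \<not> first)
                 else None)"
| "read_step G (Pad first seen a sep s) x y =
     (if x = Inl (padding G (if sep then keeps_first a else keeps_second a) s)
      then Some (Key first seen a sep, \<not> first) else None)"

fun read_end :: "'g reader \<Rightarrow> 'g + nat \<Rightarrow> bool" where
  "read_end (Key first seen a sep) y \<longleftrightarrow>
     \<comment> \<open>a label under the trailing head: the last entry is not shorter than its predecessor\<close>
     sep \<and> seen = {1..4} \<and> (\<exists>c. y = Inr c)"
| "read_end _ y \<longleftrightarrow> False"

abbreviation "reads G \<equiv> trailing_accepts (read_step G) read_end"

lemma reads_Pad:
  "reads G (Pad first seen a sep s) xs (y # ys) \<longleftrightarrow>
    (\<exists>xs'. xs = Inl (padding G (if sep then keeps_first a else keeps_second a) s) # xs' \<and>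
       reads G (Key first seen a sep) xs' (if first then y # ys else ys))"
  by (cases xs) auto

text \<open>What may follow once a complete entry is read: the end of the listing, if all labels have
  occurred, or the label of another entry.\<close>

definition continues ::
  "('g, 'm) monoid_scheme \<Rightarrow> nat set \<Rightarrow> ('g + nat) list \<Rightarrow> ('g + nat) list \<Rightarrow> bool" where
  "continues G seen xs ys \<longleftrightarrow>
     (case xs of [] \<Rightarrow> seen = {1..4}
      | x # xs' \<Rightarrow> \<exists>b\<in>{1..4}. x = Inr b \<and> reads G (Key False (insert b seen) b False) xs' ys)"

lemma reads_later_second:
  assumes "\<one>\<^bsub>G\<^esub> \<notin> set w"
  shows "reads G (Key False seen a False) xs (backward G k w @ Inl \<one>\<^bsub>G\<^esub> # ys) \<longleftrightarrow>
    (\<exists>xs'. xs = backward G (keeps_second a) w @ Inl \<one>\<^bsub>G\<^esub> # xs' \<and> reads G (Key False seen a True) xs' ys)"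
  using assms
proof (induction w arbitrary: xs)
  case Nil
  show ?case
    by (cases xs) (auto split: sum.split)
next
  case (Cons s w)
  then show ?case
    by (cases xs) (auto simp: reads_Pad split: sum.split)
qed

lemma reads_later_first:
  assumes "\<one>\<^bsub>G\<^esub> \<notin> set v"
  shows "reads G (Key False seen a True) xs (backward G k v @ Inr b # ys) \<longleftrightarrow>
    (\<exists>xs'. xs = backward G (keeps_first a) v @ xs' \<and> continues G seen xs' ys)"
  using assms
proof (induction v arbitrary: xs)
  case Nil
  show ?case
    by (cases xs) (auto simp: continues_def split: sum.split)
next
  case (Cons s v)
  then show ?case
    by (cases xs) (auto simp: reads_Pad split: sum.split)
qed

text \<open>The trailing head forces every entry after the first one to have the same \<open>v\<close> and \<open>w\<close> as its
predecessor; the label under the leading head determines the padding.\<close>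

lemma reads_later_entry:
  assumes "\<one>\<^bsub>G\<^esub> \<notin> set v" "\<one>\<^bsub>G\<^esub> \<notin> set w"
  shows "reads G (Key False seen a False) xs (backward_tail G v w c @ Inr b # ys) \<longleftrightarrow>
    (\<exists>xs'. xs = backward_tail G v w a @ xs' \<and> continues G seen xs' ys)"
  using assms by (auto simp: backward_tail_def reads_later_second reads_later_first)

text \<open>In the first entry nothing is compared, so \<open>v\<close> and \<open>w\<close> are read off rather than prescribed. They
are recovered letter by letter, by induction on what is left to read.\<close>

lemma reads_first_first:
  "reads G (Key True seen a True) xs (Inr b # ys) \<longleftrightarrow>
    (\<exists>v xs'. \<one>\<^bsub>G\<^esub> \<notin> set v \<and> xs = backward G (keeps_first a) v @ xs' \<and> continues G seen xs' ys)"
  (is "_ \<longleftrightarrow> ?R xs")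
proof (induction "length xs" arbitrary: xs rule: less_induct)
  case less
  show ?case
  proof (cases xs)
    case Nil
    then show ?thesis
      by (auto simp: continues_def intro: exI[of _ "[]"] elim: backward.elims)
  next
    case (Cons x xs1)
    show ?thesis
    proof (cases x)
      case (Inr c)
      have "xs = backward G k v @ xs' \<longleftrightarrow> v = [] \<and> xs' = xs" for k v xs'
        using Cons Inr by (cases v) auto
      then show ?thesis
        using Cons Inr by (auto simp: continues_def)
    next
      case (Inl s)
      show ?thesis
      proof (cases "s = \<one>\<^bsub>G\<^esub>")
        case True
        have "\<not> (\<one>\<^bsub>G\<^esub> \<notin> set v \<and> xs = backward G k v @ xs' \<and> continues G seen xs' ys)" for k v xs'
          using Cons Inl True by (cases v) (auto simp: continues_def)
        then show ?thesis
          using Cons Inl True by auto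
      next
        case False
        have "?R xs \<longleftrightarrow> (\<exists>xs2. xs1 = Inl (padding G (keeps_first a) s) # xs2 \<and> ?R xs2)"
        proof
          assume "?R xs"
          then obtain v xs' where v: "\<one>\<^bsub>G\<^esub> \<notin> set v" "xs = backward G (keeps_first a) v @ xs'"
              "continues G seen xs' ys" by blast
          then obtain v' where "v = s # v'"
            using Cons Inl by (cases v) (auto simp: continues_def)
          then show "\<exists>xs2. xs1 = Inl (padding G (keeps_first a) s) # xs2 \<and> ?R xs2"
            using v Cons by auto
        next
          assume "\<exists>xs2. xs1 = Inl (padding G (keeps_first a) s) # xs2 \<and> ?R xs2"
          then obtain v xs' where "\<one>\<^bsub>G\<^esub> \<notin> set v" "continues G seen xs' ys"
              "xs1 = Inl (padding G (keeps_first a) s) # backward G (keeps_first a) v @ xs'" by blast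
          then show "?R xs"
            using Cons Inl False by (intro exI[of _ "s # v"] exI[of _ xs']) auto
        qed
        moreover have "reads G (Key True seen a True) xs2 (Inr b # ys) \<longleftrightarrow> ?R xs2"
          if "xs1 = Inl (padding G (keeps_first a) s) # xs2" for xs2
          using less that Cons by simp
        ultimately show ?thesis
          using Cons Inl False by (auto simp: reads_Pad)
      qed
    qed
  qed
qed

lemma reads_first_second:
  "reads G (Key True seen a False) xs (Inr b # ys) \<longleftrightarrow>
    (\<exists>w xs'. \<one>\<^bsub>G\<^esub> \<notin> set w \<and> xs = backward G (keeps_second a) w @ Inl \<one>\<^bsub>G\<^esub> # xs' \<and>
       reads G (Key True seen a True) xs' (Inr b # ys))"
  (is "_ \<longleftrightarrow> ?R xs")
proof (induction "length xs" arbitrary: xs rule: less_induct)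
  case less
  have neq: "xs \<noteq> backward G k w @ Inl c # xs'" if "\<nexists>s xs1. xs = Inl s # xs1" for k w c xs'
    using that by (cases w) auto
  show ?case
  proof (cases "\<exists>s xs1. xs = Inl s # xs1")
    case False
    then show ?thesis
      using neq by (cases xs) (auto split: sum.split)
  next
    case True
    then obtain s xs1 where xs: "xs = Inl s # xs1" by blast
    show ?thesis
    proof (cases "s = \<one>\<^bsub>G\<^esub>")
      case True
      have eq: "\<one>\<^bsub>G\<^esub> \<notin> set w \<and> xs = backward G k w @ Inl \<one>\<^bsub>G\<^esub> # xs' \<longleftrightarrow> w = [] \<and> xs' = xs1" for k w xs'
        using xs True by (cases w) auto
      have "?R xs \<longleftrightarrow> reads G (Key True seen a True) xs1 (Inr b # ys)"
        unfolding conj_assoc[symmetric] eq by simp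
      then show ?thesis
        using xs True by simp
    next
      case False
      have "?R xs \<longleftrightarrow> (\<exists>xs2. xs1 = Inl (padding G (keeps_second a) s) # xs2 \<and> ?R xs2)"
      proof
        assume "?R xs"
        then obtain w xs' where w: "\<one>\<^bsub>G\<^esub> \<notin> set w" "xs = backward G (keeps_second a) w @ Inl \<one>\<^bsub>G\<^esub> # xs'"
            "reads G (Key True seen a True) xs' (Inr b # ys)" by blast
        then obtain w' where "w = s # w'"
          using xs False by (cases w) auto
        then show "\<exists>xs2. xs1 = Inl (padding G (keeps_second a) s) # xs2 \<and> ?R xs2"
          using w xs by auto
      next
        assume "\<exists>xs2. xs1 = Inl (padding G (keeps_second a) s) # xs2 \<and> ?R xs2"
        then obtain w xs' where "\<one>\<^bsub>G\<^esub> \<notin> set w" "reads G (Key True seen a True) xs' (Inr b # ys)"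
            "xs1 = Inl (padding G (keeps_second a) s) # backward G (keeps_second a) w @ Inl \<one>\<^bsub>G\<^esub> # xs'"
          by blast
        then show "?R xs"
          using xs False by (intro exI[of _ "s # w"] exI[of _ xs']) auto
      qed
      moreover have "reads G (Key True seen a False) xs2 (Inr b # ys) \<longleftrightarrow> ?R xs2"
        if "xs1 = Inl (padding G (keeps_second a) s) # xs2" for xs2
        using less that xs by simp
      ultimately show ?thesis
        using xs False by (auto simp: reads_Pad)
    qed
  qed
qed

lemma reads_first_entry:
  "reads G (Key True seen a False) xs (Inr b # ys) \<longleftrightarrow>
    (\<exists>v w xs'. \<one>\<^bsub>G\<^esub> \<notin> set v \<and> \<one>\<^bsub>G\<^esub> \<notin> set w \<and> xs = backward_tail G v w a @ xs' \<and> continues G seen xs' ys)"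
  unfolding reads_first_second reads_first_first backward_tail_def by auto

text \<open>The list of the trailing head starts with the word of the entry just read, followed by everything
that the leading head has yet to read. This shape is reproduced by every further entry.\<close>

lemma continues_iff:
  assumes "\<one>\<^bsub>G\<^esub> \<notin> set v" "\<one>\<^bsub>G\<^esub> \<notin> set w" "seen \<subseteq> {1..4}"
  shows "continues G seen xs (backward_tail G v w a @ xs) \<longleftrightarrow>
    (\<exists>as. seen \<union> set as = {1..4} \<and> xs = concat (map (\<lambda>a. Inr a # backward_tail G v w a) as))"
  using assms(3)
proof (induction "length xs" arbitrary: xs seen a rule: less_induct)
  case less
  show ?case
  proof (cases xs)
    case Nil
    then show ?thesis
      by (auto simp: continues_def intro: exI[of _ "[]"])
  next
    case (Cons x xs1)
    let ?e = "backward_tail G v w" and ?c = "\<lambda>as. concat (map (\<lambda>a. Inr a # backward_tail G v w a) as)"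
    have "continues G seen xs (?e a @ xs) \<longleftrightarrow>
        (\<exists>b\<in>{1..4}. x = Inr b \<and> (\<exists>xs'. xs1 = ?e b @ xs' \<and> continues G (insert b seen) xs' xs1))"
      using Cons by (auto simp: continues_def reads_later_entry[OF assms(1,2)])
    also have "\<dots> \<longleftrightarrow> (\<exists>b\<in>{1..4}. x = Inr b \<and> (\<exists>xs'. xs1 = ?e b @ xs' \<and>
        (\<exists>as. insert b seen \<union> set as = {1..4} \<and> xs' = ?c as)))"
    proof (intro bex_cong conj_cong refl ex_cong1)
      fix b xs' assume "b \<in> {1..4::nat}" "xs1 = ?e b @ xs'"
      then show "continues G (insert b seen) xs' xs1 \<longleftrightarrow>
          (\<exists>as. insert b seen \<union> set as = {1..4} \<and> xs' = ?c as)"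
        using less(1)[of xs' "insert b seen" b] less(2) Cons by simp
    qed
    also have "\<dots> \<longleftrightarrow> (\<exists>as. seen \<union> set as = {1..4} \<and> xs = ?c as)"
    proof
      assume "\<exists>b\<in>{1..4}. x = Inr b \<and> (\<exists>xs'. xs1 = ?e b @ xs' \<and>
        (\<exists>as. insert b seen \<union> set as = {1..4} \<and> xs' = ?c as))"
      then obtain b as where "x = Inr b" "xs1 = ?e b @ ?c as" "insert b seen \<union> set as = {1..4}"
        by blast
      then show "\<exists>as. seen \<union> set as = {1..4} \<and> xs = ?c as"
        using Cons by (intro exI[of _ "b # as"]) auto
    next
      assume "\<exists>as. seen \<union> set as = {1..4} \<and> xs = ?c as"
      then obtain as where as: "seen \<union> set as = {1..4}" "xs = ?c as" by blast
      then obtain b bs where "as = b # bs"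
        using Cons by (cases as) auto
      then show "\<exists>b\<in>{1..4}. x = Inr b \<and> (\<exists>xs'. xs1 = ?e b @ xs' \<and>
        (\<exists>as. insert b seen \<union> set as = {1..4} \<and> xs' = ?c as))"
        using as Cons by auto
    qed
    finally show ?thesis .
  qed
qed

lemma reads_iff:
  "reads G Start xs xs \<longleftrightarrow>
    (\<exists>v w as. \<one>\<^bsub>G\<^esub> \<notin> set v \<and> \<one>\<^bsub>G\<^esub> \<notin> set w \<and> set as = {1..4} \<and>
       xs = concat (map (\<lambda>a. Inr a # backward_tail G v w a) as))"
    (is "_ \<longleftrightarrow> ?R xs")
proof (cases xs)
  case Nil
  then show ?thesis by auto
next
  case (Cons x xs1)
  let ?c = "\<lambda>v w as. concat (map (\<lambda>a. Inr a # backward_tail G v w a) as)"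
  have "reads G Start xs xs \<longleftrightarrow> (\<exists>a\<in>{1..4}. x = Inr a \<and> reads G (Key True {a} a False) xs1 (Inr a # xs1))"
    using Cons by (auto split: sum.split)
  also have "\<dots> \<longleftrightarrow> (\<exists>a\<in>{1..4}. x = Inr a \<and>
    (\<exists>v w xs'. \<one>\<^bsub>G\<^esub> \<notin> set v \<and> \<one>\<^bsub>G\<^esub> \<notin> set w \<and> xs1 = backward_tail G v w a @ xs' \<and>
       (\<exists>as. {a} \<union> set as = {1..4} \<and> xs' = ?c v w as)))"
    unfolding reads_first_entry
  proof (intro bex_cong conj_cong refl ex_cong1)
    fix a v w xs'
    assume "a \<in> {1..4::nat}" "\<one>\<^bsub>G\<^esub> \<notin> set v" "\<one>\<^bsub>G\<^esub> \<notin> set w" "xs1 = backward_tail G v w a @ xs'"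
    then show "continues G {a} xs' xs1 \<longleftrightarrow> (\<exists>as. {a} \<union> set as = {1..4} \<and> xs' = ?c v w as)"
      using continues_iff[of G v w "{a}" xs' a] by simp
  qed
  also have "\<dots> \<longleftrightarrow> ?R xs"
  proof
    assume "\<exists>a\<in>{1..4}. x = Inr a \<and>
    (\<exists>v w xs'. \<one>\<^bsub>G\<^esub> \<notin> set v \<and> \<one>\<^bsub>G\<^esub> \<notin> set w \<and> xs1 = backward_tail G v w a @ xs' \<and>
       (\<exists>as. {a} \<union> set as = {1..4} \<and> xs' = ?c v w as))"
    then obtain a v w as where *: "x = Inr a" "\<one>\<^bsub>G\<^esub> \<notin> set v" "\<one>\<^bsub>G\<^esub> \<notin> set w"
        "xs1 = backward_tail G v w a @ ?c v w as" "{a} \<union> set as = {1..4}"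
      by blast
    show "?R xs"
      using * Cons by (intro exI[of _ v] exI[of _ w] exI[of _ "a # as"]) auto
  next
    assume "?R xs"
    then obtain v w as where *: "\<one>\<^bsub>G\<^esub> \<notin> set v" "\<one>\<^bsub>G\<^esub> \<notin> set w" "set as = {1..4}" "xs = ?c v w as"
      by blast
    moreover obtain a bs where "as = a # bs"
      using *(4) Cons by (cases as) auto
    ultimately show "\<exists>a\<in>{1..4}. x = Inr a \<and>
    (\<exists>v w xs'. \<one>\<^bsub>G\<^esub> \<notin> set v \<and> \<one>\<^bsub>G\<^esub> \<notin> set w \<and> xs1 = backward_tail G v w a @ xs' \<and>
       (\<exists>as. {a} \<union> set as = {1..4} \<and> xs' = ?c v w as))"
      using Cons by auto
  qed
  finally show ?thesis .
qed

lemma listings_of_image: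
  assumes "\<And>i. i \<in> I \<Longrightarrow> snd (f i) = i"
  shows "set l = f ` I \<longleftrightarrow> (\<exists>is. set is = I \<and> l = map f is)"
proof
  assume l: "set l = f ` I"
  have "f (snd e) = e" if "e \<in> set l" for e
    using that l assms by auto
  then have "map f (map snd l) = l"
    by (simp add: map_idI)
  moreover have "set (map snd l) = I"
    using l assms by (auto simp: image_image)
  ultimately show "\<exists>is. set is = I \<and> l = map f is" by metis
qed auto

lemma set_backward: "Inl ` set u \<subseteq> set (backward G keep u)"
  by (induction u) auto

lemma padded_in_lists:
  assumes "\<one>\<^bsub>G\<^esub> \<in> S" "\<forall>s\<in>S. inv\<^bsub>G\<^esub> s \<in> S" "u \<in> lists S"
  shows "padded G keep u \<in> lists S"
  using assms(3) by (induction u) (auto simp: padding_def assms)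

lemma position_word_in_lists:
  assumes "\<one>\<^bsub>G\<^esub> \<in> S" "\<forall>s\<in>S. inv\<^bsub>G\<^esub> s \<in> S" "v \<in> lists S" "w \<in> lists S"
  shows "position_word G v w a \<in> lists S"
  using padded_in_lists[OF assms(1,2,3)] padded_in_lists[OF assms(1,2,4)] assms(1)
  unfolding position_word_def by simp

lemma encode_listing_in_lists:
  "set l \<subseteq> lists S \<times> A \<Longrightarrow> encode_listing l \<in> lists (S <+> A)"
  by (induction l) (auto simp: encode_listing_def)

lemma mimic_coding_listings:
  "set l = mimic_coding G v w \<longleftrightarrow>
    (\<exists>as. set as = {1..4} \<and> l = map (\<lambda>a. (position_word G v w a, a)) as)"
  unfolding mimic_coding_def by (rule listings_of_image) simp

text \<open>Every listing of a coding lists the four entries, indexed by their labels, in some order and with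
repetitions; these are precisely the words that the control accepts.\<close>

lemma coding_language_mimic:
  assumes "\<one>\<^bsub>G\<^esub> \<in> S" "\<forall>s\<in>S. inv\<^bsub>G\<^esub> s \<in> S"
  shows "coding_language (mimic_codings G S) =
    {u \<in> lists (S <+> {0..4}). reads G Start (rev u) (rev u)}"
proof (intro subset_antisym subsetI)
  fix u assume "u \<in> coding_language (mimic_codings G S)"
  then obtain v w as where vw: "v \<in> lists (S - {\<one>\<^bsub>G\<^esub>})" "w \<in> lists (S - {\<one>\<^bsub>G\<^esub>})"
      and as: "set as = {1..4}"
      and u: "u = encode_listing (map (\<lambda>a. (position_word G v w a, a)) as)"
    by (auto simp: coding_language_def mimic_codings_def mimic_coding_listings)
  have "v \<in> lists S" "w \<in> lists S"
    using vw by auto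
  then have "u \<in> lists (S <+> {0..4})"
    unfolding u
  proof (intro encode_listing_in_lists subsetI)
    fix e assume "e \<in> set (map (\<lambda>a. (position_word G v w a, a)) as)"
    then obtain a where "a \<in> {1..4}" "e = (position_word G v w a, a)"
      using as by auto
    then show "e \<in> lists S \<times> {0..4}"
      using position_word_in_lists[OF assms \<open>v \<in> lists S\<close> \<open>w \<in> lists S\<close>, of a] by simp
  qed
  moreover have "reads G Start (rev u) (rev u)"
    unfolding reads_iff u rev_encode_listing
    using vw as by (intro exI[of _ "rev v"] exI[of _ "rev w"] exI[of _ "rev as"]) auto
  ultimately show "u \<in> {u \<in> lists (S <+> {0..4}). reads G Start (rev u) (rev u)}"
    by simp
next
  fix u assume "u \<in> {u \<in> lists (S <+> {0..4}). reads G Start (rev u) (rev u)}"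
  then obtain v w as where vw: "\<one>\<^bsub>G\<^esub> \<notin> set v" "\<one>\<^bsub>G\<^esub> \<notin> set w"
      and as: "set as = {1..4}"
      and u: "rev u = concat (map (\<lambda>a. Inr a # backward_tail G v w a) as)"
      and mem: "u \<in> lists (S <+> {0..4})"
    by (auto simp: reads_iff)
  have "1 \<in> set as" using as by simp
  then have "set (backward_tail G v w 1) \<subseteq> set u"
    unfolding set_rev[of u, symmetric] u by auto
  moreover have "Inl ` set v \<union> Inl ` set w \<subseteq> set (backward_tail G v w 1)"
    using set_backward[of v G "keeps_first 1"] set_backward[of w G "keeps_second 1"]
    by (auto simp: backward_tail_def)
  ultimately have "Inl ` set v \<union> Inl ` set w \<subseteq> S <+> {0..4::nat}"
    using mem by blast
  then have "v \<in> lists (S - {\<one>\<^bsub>G\<^esub>})" "w \<in> lists (S - {\<one>\<^bsub>G\<^esub>})"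
    using vw by (auto simp: in_lists_conv_set subset_iff)
  moreover have "rev u = rev (encode_listing (map (\<lambda>a. (position_word G (rev v) (rev w) a, a)) (rev as)))"
    unfolding rev_encode_listing u by simp
  then have "u = encode_listing (map (\<lambda>a. (position_word G (rev v) (rev w) a, a)) (rev as))"
    by (simp only: rev_is_rev_conv)
  moreover have "set (map (\<lambda>a. (position_word G (rev v) (rev w) a, a)) (rev as)) =
      mimic_coding G (rev v) (rev w)"
    using as by (simp add: mimic_coding_def)
  moreover have "rev v \<in> lists (S - {\<one>\<^bsub>G\<^esub>})" "rev w \<in> lists (S - {\<one>\<^bsub>G\<^esub>})"
    using calculation(1,2) by auto
  ultimately show "u \<in> coding_language (mimic_codings G S)"
    unfolding coding_language_def mimic_codings_def by blast
qed

definition reader_states :: "'g set \<Rightarrow> 'g reader set" where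
  "reader_states S = insert Start
     ((\<lambda>(first, seen, a, sep). Key first seen a sep) ` (UNIV \<times> Pow {1..4} \<times> {1..4} \<times> UNIV) \<union>
      (\<lambda>(first, seen, a, sep, s). Pad first seen a sep s) ` (UNIV \<times> Pow {1..4} \<times> {1..4} \<times> UNIV \<times> S))"

lemma reader_states_simps [simp]:
  "Start \<in> reader_states S"
  "Key first seen a sep \<in> reader_states S \<longleftrightarrow> seen \<subseteq> {1..4} \<and> a \<in> {1..4}"
  "Pad first seen a sep s \<in> reader_states S \<longleftrightarrow> seen \<subseteq> {1..4} \<and> a \<in> {1..4} \<and> s \<in> S"
  by (auto simp: reader_states_def image_iff)

lemma re_mimic_codings:
  assumes "finite S" "\<one>\<^bsub>G\<^esub> \<in> S" "\<forall>s\<in>S. inv\<^bsub>G\<^esub> s \<in> S"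
  shows "re_with_oracle (S <+> {0..4}) Orc (coding_language (mimic_codings G S))"
  unfolding coding_language_mimic[OF assms(2,3)]
proof (rule re_trailing_language)
  show "finite (S <+> {0..4::nat})"
    using assms by simp
  show "finite (reader_states S)"
    using assms by (simp add: reader_states_def)
  show "Start \<in> reader_states S"
    by simp
  fix q q' :: "'a reader" and x y :: "'a + nat" and b
  assume "q \<in> reader_states S" "x \<in> S <+> {0..4}" "read_step G q x y = Some (q', b)"
  then show "q' \<in> reader_states S"
    by (cases q) (auto split: sum.splits if_splits)
qed

section \<open>Subshifts given by pattern codings\<close>

lemma topspace_config_topology [simp]: "topspace (config_topology G A) = configs G A"
  by (simp add: config_topology_def configs_def)

lemma config_in_alphabet: "x \<in> configs G A \<Longrightarrow> g \<in> carrier G \<Longrightarrow> x g \<in> A"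
  by (auto simp: configs_def)

lemma continuous_map_evaluate:
  assumes "g \<in> carrier G"
  shows "continuous_map (config_topology G A) (discrete_topology A) (\<lambda>x. x g)"
  unfolding config_topology_def
  by (rule continuous_map_product_projection[OF assms, of "\<lambda>_. discrete_topology A"])

lemma openin_cylinder:
  assumes "g \<in> carrier G"
  shows "openin (config_topology G A) (cylinder G A a g)"
proof -
  have "cylinder G A a g = {x \<in> topspace (config_topology G A). x g \<in> {a} \<inter> A}"
    using assms by (auto simp: cylinder_def config_in_alphabet)
  then show ?thesis
    using openin_continuous_map_preimage[OF continuous_map_evaluate[OF assms, of A], of "{a} \<inter> A"]
    by simp
qed

lemma shift_apply: "h \<in> carrier G \<Longrightarrow> shift G g x h = x (inv\<^bsub>G\<^esub> g \<otimes>\<^bsub>G\<^esub> h)"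
  by (simp add: shift_def)

context group
begin

lemma shift_configs:
  assumes "g \<in> carrier G" "x \<in> configs G A"
  shows "shift G g x \<in> configs G A"
  using assms by (auto simp: configs_def shift_def)

lemma word_value_closed: "w \<in> lists (carrier G) \<Longrightarrow> word_value G w \<in> carrier G"
  by (induction w) (auto simp: word_value_def)

lemma word_value_Cons: "word_value G (s # w) = s \<otimes> word_value G w"
  by (simp add: word_value_def)

lemma word_value_Nil: "word_value G [] = \<one>"
  by (simp add: word_value_def)

lemma word_value_append:
  assumes "u \<in> lists (carrier G)" "w \<in> lists (carrier G)"
  shows "word_value G (u @ w) = word_value G u \<otimes> word_value G w"
  using assms
  by (induction u) (auto simp: word_value_Nil word_value_Cons word_value_closed m_assoc)

text \<open>The inverse of a generator is again in \<open>S\<close>, and letters \<open>\<one>\<close> can be dropped from a word.\<close>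

lemma generated_word_value:
  assumes "S \<subseteq> carrier G" "\<forall>s\<in>S. inv s \<in> S" "g \<in> generate G S"
  shows "\<exists>w \<in> lists (S - {\<one>}). word_value G w = g"
  using assms(3)
proof induction
  case one
  show ?case
    by (rule bexI[of _ "[]"]) (auto simp: word_value_Nil)
next
  case (incl h)
  then show ?case
    using assms
    by (cases "h = \<one>")
      (auto intro: bexI[of _ "[]"] bexI[of _ "[h]"] simp: word_value_Nil word_value_Cons subset_iff)
next
  case (inv h)
  have "inv h = \<one> \<or> inv h \<in> S - {\<one>}" "inv h \<in> carrier G"
    using inv assms by auto
  then show ?case
    by (auto intro: bexI[of _ "[]"] bexI[of _ "[inv h]"] simp: word_value_Nil word_value_Cons)
next
  case (eng h1 h2)
  then obtain u w where "u \<in> lists (S - {\<one>})" "word_value G u = h1"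
      "w \<in> lists (S - {\<one>})" "word_value G w = h2"
    by blast
  moreover have "lists (S - {\<one>}) \<subseteq> lists (carrier G)"
    using assms by (intro lists_mono) auto
  ultimately show ?case
    using word_value_append[of u w] by (intro bexI[of _ "u @ w"]) auto
qed

lemma mem_coding_subshift_iff:
  "x \<in> coding_subshift G A C \<longleftrightarrow> x \<in> configs G A \<and>
     (\<forall>g\<in>carrier G. \<forall>c\<in>C. \<exists>(w, a)\<in>c. x (g \<otimes> word_value G w) \<noteq> a)"
proof -
  have eq: "x \<in> configs G A - (\<Inter>(w, a)\<in>c. cylinder G A a (g \<otimes> word_value G w)) \<longleftrightarrow>
      (\<exists>(w, a)\<in>c. x (g \<otimes> word_value G w) \<noteq> a)" if "x \<in> configs G A" for g c
    using that unfolding cylinder_def case_prod_unfold by auto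
  then show ?thesis
    unfolding coding_subshift_def Int_iff INT_iff
    by (intro conj_cong refl ball_cong) (rule eq)
qed

text \<open>A configuration violates a coding at a given place by finitely many of its values, so the
violating configurations form an open set.\<close>

lemma subshift_coding_subshift:
  assumes "finite A" "S \<subseteq> carrier G" "C \<subseteq> pattern_codings S A"
  shows "subshift G A (coding_subshift G A C)"
proof -
  have val: "word_value G w \<in> carrier G" if "c \<in> C" "(w, a) \<in> c" for c w a
  proof (rule word_value_closed)
    have "w \<in> lists S"
      using that assms(3) by (auto simp: pattern_codings_def)
    then show "w \<in> lists (carrier G)"
      using lists_mono[OF assms(2)] by blast
  qed
  have "openin (config_topology G A)
     (configs G A \<inter> (\<Inter>(w, a)\<in>c. cylinder G A a (g \<otimes> word_value G w)))"
    if "g \<in> carrier G" "c \<in> C" for g c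
  proof (cases "c = {}")
    case True
    then show ?thesis
      using openin_topspace[of "config_topology G A"] by simp
  next
    case False
    have "finite c"
      using that assms by (auto simp: pattern_codings_def)
    then show ?thesis
      using False that val
      by (intro openin_Int openin_INT2) (auto intro!: openin_cylinder
          openin_topspace[of "config_topology G A", simplified])
  qed
  then have "openin (config_topology G A) (\<Union>g\<in>carrier G. \<Union>c\<in>C.
     configs G A \<inter> (\<Inter>(w, a)\<in>c. cylinder G A a (g \<otimes> word_value G w)))"
    by (intro openin_Union ballI; elim imageE; simp only:; intro openin_Union ballI; elim imageE; simp only:)
  moreover have "configs G A - (\<Union>g\<in>carrier G. \<Union>c\<in>C.
     configs G A \<inter> (\<Inter>(w, a)\<in>c. cylinder G A a (g \<otimes> word_value G w))) = coding_subshift G A C"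
    unfolding coding_subshift_def by blast
  ultimately have "closedin (config_topology G A) (coding_subshift G A C)"
    using closedin_diff[OF closedin_topspace] by (metis topspace_config_topology)
  moreover have "shift G k x \<in> coding_subshift G A C"
    if k: "k \<in> carrier G" and x: "x \<in> coding_subshift G A C" for k x
  proof -
    have "\<exists>(w, a)\<in>c. shift G k x (g \<otimes> word_value G w) \<noteq> a" if "g \<in> carrier G" "c \<in> C" for g c
    proof -
      have "inv k \<otimes> g \<in> carrier G"
        using k that by simp
      then have "\<exists>(w, a)\<in>c. x (inv k \<otimes> g \<otimes> word_value G w) \<noteq> a"
        using x that(2) mem_coding_subshift_iff by blast
      then obtain w a where wa: "(w, a) \<in> c" "x (inv k \<otimes> g \<otimes> word_value G w) \<noteq> a"
        by auto
      then show ?thesis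
        using that k val[OF that(2) wa(1)] by (intro bexI[of _ "(w, a)"]) (auto simp: shift_apply m_assoc)
    qed
    then show ?thesis
      using x k by (auto simp: mem_coding_subshift_iff shift_configs)
  qed
  ultimately show ?thesis
    using assms by (auto simp: subshift_def)
qed

section \<open>Factor maps have finite windows\<close>

text \<open>The theorem of Curtis, Hedlund and Lyndon: \<open>\<phi> z g\<close> depends on \<open>z\<close> only inside a finite window
  around \<open>g\<close>. The value at \<open>\<one>\<close> is a continuous function on a compact space with values in a discrete
  one, so around each point finitely many coordinates decide it, and finitely many such
  neighbourhoods cover the space. Equivariance transports the window to the other positions.\<close>

lemma factor_map_local:
  assumes Z: "subshift G B Z"
    and cont: "continuous_map (subtopology (config_topology G B) Z) (subtopology (config_topology G A) Y) \<phi>"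
    and equiv: "\<forall>g\<in>carrier G. \<forall>z\<in>Z. \<phi> (shift G g z) = shift G g (\<phi> z)"
  shows "\<exists>D. finite D \<and> D \<subseteq> carrier G \<and>
    (\<forall>g\<in>carrier G. \<forall>z\<in>Z. \<forall>z'\<in>Z. (\<forall>d\<in>D. z (g \<otimes> d) = z' (g \<otimes> d)) \<longrightarrow> \<phi> z g = \<phi> z' g)"
proof -
  let ?T = "config_topology G B"
  have ZB: "Z \<subseteq> configs G B" and fin: "finite B"
    using Z closedin_subset unfolding subshift_def by fastforce+
  have "compact_space ?T"
    unfolding config_topology_def using fin
    by (simp add: compact_space_product_topology compact_space_discrete_topology)
  then have comp: "compactin ?T Z"
    using Z closedin_compact_space by (auto simp: subshift_def)
  have eval: "continuous_map (subtopology ?T Z) (discrete_topology A) (\<lambda>z. \<phi> z \<one>)"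
    using continuous_map_compose[OF continuous_map_into_fulltopology[OF cont]
        continuous_map_evaluate[OF one_closed]]
    by (simp add: o_def)
  define decides where "decides z U D \<longleftrightarrow> openin ?T U \<and> z \<in> U \<and> finite D \<and> D \<subseteq> carrier G \<and>
      (\<forall>y\<in>U. \<forall>z'\<in>Z. (\<forall>d\<in>D. z' d = y d) \<longrightarrow> \<phi> z' \<one> = \<phi> z \<one>)" for z U D
  have "\<exists>U D. decides z U D" if "z \<in> Z" for z
  proof -
    have "\<phi> z \<one> \<in> A"
      using continuous_map_funspace[OF eval] that ZB by auto
    then have "openin (subtopology ?T Z) {z' \<in> topspace (subtopology ?T Z). \<phi> z' \<one> \<in> {\<phi> z \<one>}}"
      by (intro openin_continuous_map_preimage[OF eval]) simp
    then obtain V where V: "openin ?T V"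
        "{z' \<in> topspace (subtopology ?T Z). \<phi> z' \<one> \<in> {\<phi> z \<one>}} = V \<inter> Z"
      unfolding openin_subtopology by blast
    have "z \<in> V" using V that ZB by auto
    then obtain W where W: "finite {i \<in> carrier G. W i \<noteq> B}" "z \<in> Pi\<^sub>E (carrier G) W"
        "Pi\<^sub>E (carrier G) W \<subseteq> V" "\<And>i. i \<in> carrier G \<Longrightarrow> W i \<subseteq> B"
      using V(1) unfolding config_topology_def openin_product_topology_alt by fastforce
    let ?D = "{i \<in> carrier G. W i \<noteq> B}"
    have "openin ?T (Pi\<^sub>E (carrier G) W)"
      unfolding config_topology_def openin_PiE_gen using W
      by (auto simp: )
    moreover have "\<phi> z' \<one> = \<phi> z \<one>"
      if "y \<in> Pi\<^sub>E (carrier G) W" "z' \<in> Z" "\<forall>d\<in>?D. z' d = y d" for y z'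
    proof -
      have "z' d \<in> W d" if "d \<in> carrier G" for d
        using \<open>y \<in> _\<close> \<open>z' \<in> Z\<close> \<open>\<forall>d\<in>?D. z' d = y d\<close> that ZB
        by (cases "W d = B") (auto simp: config_in_alphabet subset_iff)
      then have "z' \<in> V \<inter> Z"
        using \<open>z' \<in> Z\<close> ZB W(3) by (auto simp: configs_def PiE_iff subset_iff)
      then show ?thesis
        using V(2) by blast
    qed
    ultimately have "decides z (Pi\<^sub>E (carrier G) W) ?D"
      unfolding decides_def using W(1,2) by blast
    then show ?thesis by blast
  qed
  then obtain U D where UD: "\<And>z. z \<in> Z \<Longrightarrow> decides z (U z) (D z)"
    by metis
  have U: "\<And>z. z \<in> Z \<Longrightarrow> openin ?T (U z)" "\<And>z. z \<in> Z \<Longrightarrow> z \<in> U z"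
      and D: "\<And>z. z \<in> Z \<Longrightarrow> finite (D z)" "\<And>z. z \<in> Z \<Longrightarrow> D z \<subseteq> carrier G"
        "\<And>z y z'. \<lbrakk>z \<in> Z; y \<in> U z; z' \<in> Z; \<forall>d\<in>D z. z' d = y d\<rbrakk> \<Longrightarrow> \<phi> z' \<one> = \<phi> z \<one>"
    using UD unfolding decides_def by blast+
  have "\<forall>V\<in>U ` Z. openin ?T V" "Z \<subseteq> \<Union> (U ` Z)" using U by auto
  then obtain \<F> where "finite \<F>" "\<F> \<subseteq> U ` Z" "Z \<subseteq> \<Union> \<F>"
    using comp unfolding compactin_def by metis
  then obtain Z0 where Z0: "finite Z0" "Z0 \<subseteq> Z" "Z \<subseteq> \<Union> (U ` Z0)"
    by (metis finite_subset_image)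
  have one: "\<phi> z \<one> = \<phi> z' \<one>" if "z \<in> Z" "z' \<in> Z" "\<forall>d\<in>\<Union> (D ` Z0). z d = z' d" for z z'
  proof -
    have "\<exists>z0\<in>Z0. z \<in> U z0" using Z0 that(1) by blast
    then obtain z0 where "z0 \<in> Z0" "z \<in> U z0" ..
    then show ?thesis
      using D(3)[of z0 z z] D(3)[of z0 z z'] that Z0 by (auto simp: subset_iff)
  qed
  have "\<phi> z g = \<phi> z' g"
    if g: "g \<in> carrier G" and z: "z \<in> Z" "z' \<in> Z"
      and eq: "\<forall>d\<in>\<Union> (D ` Z0). z (g \<otimes> d) = z' (g \<otimes> d)" for g z z'
  proof -
    have sub: "\<Union> (D ` Z0) \<subseteq> carrier G" using D Z0 by blast
    have "shift G (inv g) z \<in> Z" "shift G (inv g) z' \<in> Z"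
      using Z g z by (auto simp: subshift_def)
    moreover have "\<forall>d\<in>\<Union> (D ` Z0). shift G (inv g) z d = shift G (inv g) z' d"
      using eq sub g by (auto simp: shift_apply subset_iff)
    ultimately have "\<phi> (shift G (inv g) z) \<one> = \<phi> (shift G (inv g) z') \<one>"
      by (rule one)
    then show ?thesis
      using equiv g z by (simp add: shift_apply)
  qed
  moreover have "finite (\<Union> (D ` Z0))" "\<Union> (D ` Z0) \<subseteq> carrier G"
    using D Z0 by (auto simp: subset_iff)
  ultimately show ?thesis
    by (intro exI[of _ "\<Union> (D ` Z0)"] conjI ballI impI)
qed

end

section \<open>The mimic shift is effectively closed\<close>

text \<open>A position \<open>g\<close> with label 1 and a position \<open>gt\<close> with label 2 form a pair of markers. They ask that
what is seen from \<open>gt\<close> mimics what is seen from \<open>g\<close>: a label 3 at \<open>gh\<close> excludes a label 4 at the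
corresponding position \<open>gth\<close>.\<close>

definition mimic_shift :: "('g, 'm) monoid_scheme \<Rightarrow> ('g \<Rightarrow> nat) set" where
  "mimic_shift G = {x \<in> configs G {0..4}. \<forall>g\<in>carrier G. \<forall>t\<in>carrier G. \<forall>h\<in>carrier G.
     \<not> (x g = 1 \<and> x (g \<otimes>\<^bsub>G\<^esub> t) = 2 \<and> x (g \<otimes>\<^bsub>G\<^esub> h) = 3 \<and> x (g \<otimes>\<^bsub>G\<^esub> (t \<otimes>\<^bsub>G\<^esub> h)) = 4)}"

context group
begin

lemma word_value_padded:
  assumes "u \<in> lists (carrier G)"
  shows "word_value G (padded G keep u) = (if keep then word_value G u else \<one>)"
  using assms
proof (induction u)
  case (Cons s u)
  then have "u \<in> lists (carrier G)" "s \<in> carrier G" by auto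
  then show ?case
    using Cons.IH word_value_closed[of u]
    by (auto simp: word_value_Cons padding_def m_assoc[symmetric])
qed (simp add: word_value_Nil)

lemma padded_carrier: "u \<in> lists (carrier G) \<Longrightarrow> padded G keep u \<in> lists (carrier G)"
  by (rule padded_in_lists) auto

lemma word_value_position_word:
  assumes "v \<in> lists (carrier G)" "w \<in> lists (carrier G)"
  shows "word_value G (position_word G v w a) =
    (if keeps_first a then word_value G v else \<one>) \<otimes> (if keeps_second a then word_value G w else \<one>)"
proof -
  have "\<one> # padded G k w \<in> lists (carrier G)" for k
    using padded_carrier[OF assms(2)] by simp
  then show ?thesis
    unfolding position_word_def
    using assms word_value_append[OF padded_carrier[OF assms(1)]] word_value_closed
    by (auto simp: word_value_Cons word_value_padded)
qed

text \<open>The words \<open>v\<close> and \<open>w\<close> of a coding range over representatives of all pairs of group elements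
\<open>t\<close> and \<open>h\<close>.\<close>

lemma coding_subshift_mimic_codings:
  assumes "S \<subseteq> carrier G" "\<forall>s\<in>S. inv s \<in> S" "generate G S = carrier G"
  shows "coding_subshift G {0..4} (mimic_codings G S) = mimic_shift G"
proof -
  have sub: "lists (S - {\<one>}) \<subseteq> lists (carrier G)"
    using assms(1) by (intro lists_mono) auto
  have occurs: "(\<exists>(u, a)\<in>mimic_coding G v w. x (g \<otimes> word_value G u) \<noteq> a) \<longleftrightarrow>
      \<not> (x g = 1 \<and> x (g \<otimes> word_value G v) = 2 \<and> x (g \<otimes> word_value G w) = 3 \<and>
         x (g \<otimes> (word_value G v \<otimes> word_value G w)) = 4)"
    if "g \<in> carrier G" "v \<in> lists (carrier G)" "w \<in> lists (carrier G)" for x :: "'a \<Rightarrow> nat" and g v w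
  proof -
    have "{1..4::nat} = {1, 2, 3, 4}" by auto
    then show ?thesis
      using that
      by (simp add: mimic_coding_def word_value_position_word word_value_closed keeps_first_def keeps_second_def)
  qed
  have avoids: "(\<forall>c\<in>mimic_codings G S. \<exists>(u, a)\<in>c. x (g \<otimes> word_value G u) \<noteq> a) \<longleftrightarrow>
    (\<forall>t\<in>carrier G. \<forall>h\<in>carrier G.
     \<not> (x g = 1 \<and> x (g \<otimes> t) = 2 \<and> x (g \<otimes> h) = 3 \<and> x (g \<otimes> (t \<otimes> h)) = 4))"
    (is "?L \<longleftrightarrow> ?R") if g: "g \<in> carrier G" for x :: "'a \<Rightarrow> nat" and g
  proof
    assume L: ?L
    show ?R
    proof (intro ballI)
      fix t h assume "t \<in> carrier G" "h \<in> carrier G"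
      then obtain v w where vw: "v \<in> lists (S - {\<one>})" "word_value G v = t"
          "w \<in> lists (S - {\<one>})" "word_value G w = h"
        using generated_word_value[OF assms(1,2), of t] generated_word_value[OF assms(1,2), of h]
        unfolding assms(3) by blast
      then have "mimic_coding G v w \<in> mimic_codings G S"
        unfolding mimic_codings_def by blast
      with L have "\<exists>(u, a)\<in>mimic_coding G v w. x (g \<otimes> word_value G u) \<noteq> a" ..
      then show "\<not> (x g = 1 \<and> x (g \<otimes> t) = 2 \<and> x (g \<otimes> h) = 3 \<and> x (g \<otimes> (t \<otimes> h)) = 4)"
        unfolding occurs[OF g subsetD[OF sub vw(1)] subsetD[OF sub vw(3)]] vw(2,4) .
    qed
  next
    assume R: ?R
    show ?L
    proof
      fix c assume "c \<in> mimic_codings G S"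
      then obtain v w where c: "c = mimic_coding G v w"
          and vw: "v \<in> lists (carrier G)" "w \<in> lists (carrier G)"
        using sub unfolding mimic_codings_def by blast
      have "\<not> (x g = 1 \<and> x (g \<otimes> word_value G v) = 2 \<and> x (g \<otimes> word_value G w) = 3 \<and>
         x (g \<otimes> (word_value G v \<otimes> word_value G w)) = 4)"
        by (rule R[rule_format, OF word_value_closed[OF vw(1)] word_value_closed[OF vw(2)]])
      then show "\<exists>(u, a)\<in>c. x (g \<otimes> word_value G u) \<noteq> a"
        unfolding c occurs[OF g vw] .
    qed
  qed
  show ?thesis
    by (intro Set.set_eqI) (simp only: mem_coding_subshift_iff mimic_shift_def mem_Collect_eq avoids cong: ball_cong)
qed

lemma mimic_codings_are_codings:
  assumes "\<one> \<in> S" "\<forall>s\<in>S. inv s \<in> S"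
  shows "mimic_codings G S \<subseteq> pattern_codings S {0..4}"
proof
  fix c assume "c \<in> mimic_codings G S"
  then obtain v w where c: "c = mimic_coding G v w" and vw: "v \<in> lists S" "w \<in> lists S"
    unfolding mimic_codings_def by auto
  show "c \<in> pattern_codings S {0..4}"
    unfolding c pattern_codings_def mimic_coding_def
    using position_word_in_lists[OF assms vw] by (auto simp del: in_lists_conv_set)
qed

lemma effectively_closed_mimic_shift:
  assumes "finite S" "S \<subseteq> carrier G" "\<one> \<in> S" "\<forall>s\<in>S. inv s \<in> S" "generate G S = carrier G"
  shows "effectively_closed G S {0..4} (mimic_shift G)"
  unfolding effectively_closed_def
  using subshift_coding_subshift[OF _ assms(2) mimic_codings_are_codings[OF assms(3,4)]]
    mimic_codings_are_codings[OF assms(3,4)] re_mimic_codings[OF assms(1,3,4)]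
    coding_subshift_mimic_codings[OF assms(2,4,5)]
  by (metis finite_atLeastAtMost)

end

section \<open>Splicing and thin boundaries\<close>

text \<open>The points of \<open>F\<close> lying in a translate of \<open>D\<close> that leaves \<open>F\<close>. If two configurations agree on these
points, every translate of \<open>D\<close> sees only one of them in the spliced configuration.\<close>

definition window_boundary :: "('g, 'm) monoid_scheme \<Rightarrow> 'g set \<Rightarrow> 'g set \<Rightarrow> 'g set" where
  "window_boundary G D F =
     {f \<in> F. \<exists>g\<in>carrier G. \<exists>d\<in>D. \<exists>d'\<in>D. f = g \<otimes>\<^bsub>G\<^esub> d \<and> g \<otimes>\<^bsub>G\<^esub> d' \<notin> F}"

definition spliced :: "('g, 'm) monoid_scheme \<Rightarrow> 'g set \<Rightarrow> ('g \<Rightarrow> 'a) \<Rightarrow> ('g \<Rightarrow> 'a) \<Rightarrow> 'g \<Rightarrow> 'a" where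
  "spliced G F z z' = (\<lambda>h\<in>carrier G. if h \<in> F then z h else z' h)"

context group
begin

lemma spliced_window:
  assumes agree: "\<forall>f\<in>window_boundary G D F. z f = z' f"
    and g: "g \<in> carrier G" and D: "D \<subseteq> carrier G"
  shows "(\<forall>d\<in>D. g \<otimes> d \<in> F) \<Longrightarrow> \<forall>d\<in>D. spliced G F z z' (g \<otimes> d) = z (g \<otimes> d)"
    and "\<not> (\<forall>d\<in>D. g \<otimes> d \<in> F) \<Longrightarrow> \<forall>d\<in>D. spliced G F z z' (g \<otimes> d) = z' (g \<otimes> d)"
proof -
  show "\<forall>d\<in>D. spliced G F z z' (g \<otimes> d) = z (g \<otimes> d)" if "\<forall>d\<in>D. g \<otimes> d \<in> F"
    using that g D by (auto simp: spliced_def subset_iff)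
next
  assume "\<not> (\<forall>d\<in>D. g \<otimes> d \<in> F)"
  then have "g \<otimes> d \<in> window_boundary G D F" if "d \<in> D" "g \<otimes> d \<in> F" for d
    using that g unfolding window_boundary_def by blast
  then show "\<forall>d\<in>D. spliced G F z z' (g \<otimes> d) = z' (g \<otimes> d)"
    using agree g D by (auto simp: spliced_def subset_iff)
qed

text \<open>With the union of the supports of the forbidden patterns as window, a forbidden pattern in the
spliced configuration would already occur in one of the two given ones.\<close>

lemma sft_splice:
  assumes "sft G B Z"
  shows "\<exists>D. finite D \<and> D \<subseteq> carrier G \<and> (\<forall>F. \<forall>z\<in>Z. \<forall>z'\<in>Z.
    (\<forall>f\<in>window_boundary G D F. z f = z' f) \<longrightarrow> spliced G F z z' \<in> Z)"
proof -
  obtain P where P: "finite P" "P \<subseteq> patterns G B"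
    and Z: "Z = configs G B \<inter> (\<Inter>(F, p)\<in>P. \<Inter>g\<in>carrier G.
               configs G B - (\<Inter>h\<in>F. cylinder G B (p h) (g \<otimes> h)))"
    using assms unfolding sft_def by blast
  have mem: "z \<in> Z \<longleftrightarrow> z \<in> configs G B \<and> (\<forall>(E, p)\<in>P. \<forall>g\<in>carrier G. \<exists>h\<in>E. z (g \<otimes> h) \<noteq> p h)" for z
  proof -
    have eq: "z \<in> configs G B - (\<Inter>h\<in>E. cylinder G B (p h) (g \<otimes> h)) \<longleftrightarrow>
        (\<exists>h\<in>E. z (g \<otimes> h) \<noteq> p h)" if "z \<in> configs G B" for E p g
      using that unfolding cylinder_def by auto
    show ?thesis
      unfolding Z Int_iff case_prod_unfold INT_iff
      by (intro conj_cong refl ball_cong) (rule eq)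
  qed
  define D where "D = \<Union> (fst ` P)"
  have "finite E \<and> E \<subseteq> carrier G" if "(E, p) \<in> P" for E p
    using subsetD[OF P(2) that] by (simp add: patterns_def)
  then have "\<forall>e\<in>P. finite (fst e) \<and> fst e \<subseteq> carrier G"
    by (metis prod.collapse)
  then have D: "finite D" "D \<subseteq> carrier G"
    using P(1) unfolding D_def by blast+
  have "spliced G F z z' \<in> Z"
    if z: "z \<in> Z" "z' \<in> Z" and agree: "\<forall>f\<in>window_boundary G D F. z f = z' f" for F z z'
    unfolding mem
  proof (intro conjI ballI)
    show "spliced G F z z' \<in> configs G B"
      using z unfolding mem by (auto simp: spliced_def configs_def)
  next
    fix e assume "e \<in> P"
    obtain E p where e: "e = (E, p)" by (cases e)
    have "\<exists>h\<in>E. spliced G F z z' (g \<otimes> h) \<noteq> p h" if g: "g \<in> carrier G" for g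
    proof -
      have "E \<subseteq> D"
        using \<open>e \<in> P\<close> e by (force simp: D_def)
      consider "\<forall>d\<in>D. spliced G F z z' (g \<otimes> d) = z (g \<otimes> d)"
        | "\<forall>d\<in>D. spliced G F z z' (g \<otimes> d) = z' (g \<otimes> d)"
        using spliced_window[OF agree g D(2)] by blast
      then have "\<exists>y\<in>Z. \<forall>d\<in>D. spliced G F z z' (g \<otimes> d) = y (g \<otimes> d)"
      proof cases
        case 1
        then show ?thesis by (rule bexI[OF _ z(1)])
      next
        case 2
        then show ?thesis by (rule bexI[OF _ z(2)])
      qed
      then obtain y where y: "y \<in> Z" "\<forall>d\<in>D. spliced G F z z' (g \<otimes> d) = y (g \<otimes> d)" ..
      have "\<forall>(E, p)\<in>P. \<forall>g\<in>carrier G. \<exists>h\<in>E. y (g \<otimes> h) \<noteq> p h"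
        using y(1) unfolding mem by (rule conjunct2)
      from bspec[OF this \<open>e \<in> P\<close>] have "\<exists>h\<in>E. y (g \<otimes> h) \<noteq> p h"
        using g by (simp add: e)
      then obtain h where "h \<in> E" "y (g \<otimes> h) \<noteq> p h" ..
      moreover have "spliced G F z z' (g \<otimes> h) = y (g \<otimes> h)"
        using y(2) \<open>E \<subseteq> D\<close> \<open>h \<in> E\<close> by blast
      ultimately show ?thesis
        by (intro bexI[of _ h]) simp_all
    qed
    then show "case e of (E, p) \<Rightarrow> \<forall>g\<in>carrier G. \<exists>h\<in>E. spliced G F z z' (g \<otimes> h) \<noteq> p h"
      unfolding e by simp
  qed
  then show ?thesis
    using D by blast
qed

lemma window_boundary_mono: "D \<subseteq> D' \<Longrightarrow> window_boundary G D F \<subseteq> window_boundary G D' F"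
  unfolding window_boundary_def by blast

text \<open>If \<open>f = gd\<close> and \<open>gd'\<close> is outside \<open>F\<close>, then \<open>f\<close> is outside \<open>F (inv d' d)\<close>. So the boundary is
covered by the sets \<open>F - Fk\<close> with \<open>k\<close> in the finite set of the elements \<open>inv d' d\<close>.\<close>

lemma amenable_small_window_boundary:
  assumes "amenable G" "finite D" "D \<noteq> {}" "D \<subseteq> carrier G"
  shows "\<exists>F. finite F \<and> F \<subseteq> carrier G \<and> n * card (window_boundary G D F) < card F"
proof -
  define K where "K = (\<lambda>(d, d'). inv d' \<otimes> d) ` (D \<times> D)"
  have K: "finite K" "K \<subseteq> carrier G" "K \<noteq> {}"
    using assms by (auto simp: K_def)
  \<comment> \<open>\<open>Suc n\<close> instead of \<open>n\<close> keeps \<open>\<epsilon>\<close> positive for \<open>n = 0\<close>\<close>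
  define \<epsilon> where "\<epsilon> = 1 / (real (Suc n) * real (card K))"
  have cK: "real (card K) > 0"
    using K by (simp add: card_gt_0_iff)
  then have "\<epsilon> > 0"
    by (simp add: \<epsilon>_def)
  then obtain F where F: "finite F" "F \<noteq> {}" "F \<subseteq> carrier G"
      and small: "\<And>k. k \<in> K \<Longrightarrow> real (card (F - (F #> k))) < \<epsilon> * real (card F)"
    using assms(1) K unfolding amenable_def by metis
  have sub: "window_boundary G D F \<subseteq> (\<Union>k\<in>K. F - (F #> k))"
  proof
    fix f assume "f \<in> window_boundary G D F"
    then obtain g d d' where *: "f \<in> F" "g \<in> carrier G" "d \<in> D" "d' \<in> D" "f = g \<otimes> d" "g \<otimes> d' \<notin> F"
      unfolding window_boundary_def by blast
    have car: "d \<in> carrier G" "d' \<in> carrier G" using * assms by auto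
    have "f \<notin> F #> (inv d' \<otimes> d)"
    proof
      assume "f \<in> F #> (inv d' \<otimes> d)"
      then obtain e where e: "e \<in> F" "f = e \<otimes> (inv d' \<otimes> d)"
        unfolding r_coset_def by blast
      then have "e \<in> carrier G" using F by blast
      then have "g = e \<otimes> inv d'"
        using e * car by (metis inv_closed m_assoc m_closed right_cancel)
      then have "g \<otimes> d' = e"
        using car \<open>e \<in> carrier G\<close> by (simp add: m_assoc)
      then show False using e * by simp
    qed
    moreover have "inv d' \<otimes> d \<in> K" using * by (force simp: K_def)
    ultimately show "f \<in> (\<Union>k\<in>K. F - (F #> k))" using * by blast
  qed
  have "card (window_boundary G D F) \<le> card (\<Union>k\<in>K. F - (F #> k))"
    using F K by (intro card_mono[OF _ sub]) auto
  also have "\<dots> \<le> (\<Sum>k\<in>K. card (F - (F #> k)))"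
    by (rule card_UN_le[OF K(1)])
  finally have "real (card (window_boundary G D F)) \<le> (\<Sum>k\<in>K. real (card (F - (F #> k))))"
    by (metis of_nat_le_iff of_nat_sum)
  also have "\<dots> < (\<Sum>k\<in>K. \<epsilon> * real (card F))"
    using K small by (intro sum_strict_mono) auto
  also have "\<dots> = real (card F) / real (Suc n)"
    using cK by (simp add: \<epsilon>_def)
  finally have "real (Suc n) * real (card (window_boundary G D F)) < real (card F)"
    by (simp add: field_simps)
  then have "Suc n * card (window_boundary G D F) < card F"
    by (metis of_nat_less_iff of_nat_mult)
  then show ?thesis
    using F by (intro exI[of _ F]) auto
qed

end

section \<open>The mimic shift is not sofic\<close>

text \<open>A set \<open>P \<subseteq> E\<close> is written with the label 3, and its complement in \<open>E\<close> is written on the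
translate \<open>\<tau>E\<close> with the label 4. Thus the values on \<open>\<tau>E\<close> allow on \<open>E\<close> no set but the subsets
of \<open>P\<close>. The markers are \<open>p\<close> and \<open>\<tau>p\<close>: in
the mimic rule with \<open>g = p\<close> and \<open>gt = \<tau>p\<close>, the position that corresponds to \<open>gh\<close> is
\<open>gth = \<tau>(gh)\<close>.\<close>

definition mimic_config :: "('g, 'm) monoid_scheme \<Rightarrow> 'g \<Rightarrow> 'g \<Rightarrow> 'g set \<Rightarrow> 'g set \<Rightarrow> 'g \<Rightarrow> nat" where
  "mimic_config G p \<tau> E P = (\<lambda>h\<in>carrier G.
     if h = p then 1 else if h = \<tau> \<otimes>\<^bsub>G\<^esub> p then 2 else if h \<in> P then 3
     else if h \<in> (\<lambda>e. \<tau> \<otimes>\<^bsub>G\<^esub> e) ` (E - P) then 4 else 0)"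

context group
begin

lemma exists_displacement:
  assumes "infinite (carrier G)" "finite F" "F \<subseteq> carrier G"
  shows "\<exists>\<tau>\<in>carrier G. \<forall>f\<in>F. \<tau> \<otimes> f \<notin> F"
proof -
  have "finite ((\<lambda>(f, f'). f \<otimes> inv f') ` (F \<times> F))"
    using assms by simp
  then obtain \<tau> where \<tau>: "\<tau> \<in> carrier G" "\<tau> \<notin> (\<lambda>(f, f'). f \<otimes> inv f') ` (F \<times> F)"
    using assms(1) by (meson finite_subset subsetI)
  have "\<tau> \<otimes> f \<notin> F" if f: "f \<in> F" for f
  proof
    assume "\<tau> \<otimes> f \<in> F"
    then have "(\<tau> \<otimes> f) \<otimes> inv f \<in> (\<lambda>(f, f'). f \<otimes> inv f') ` (F \<times> F)"
      using f by force
    moreover have "(\<tau> \<otimes> f) \<otimes> inv f = \<tau>"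
      using f \<tau> assms(3) by (auto simp: m_assoc)
    ultimately show False using \<tau> by simp
  qed
  then show ?thesis using \<tau> by blast
qed

lemma mimic_config_in_mimic_shift:
  assumes p: "p \<in> carrier G" and \<tau>: "\<tau> \<in> carrier G" and E: "E \<subseteq> carrier G"
  shows "mimic_config G p \<tau> E P \<in> mimic_shift G"
proof -
  let ?x = "mimic_config G p \<tau> E P"
  have "?x \<in> configs G {0..4}"
    by (auto simp: mimic_config_def configs_def)
  moreover have False
    if "g \<in> carrier G" "t \<in> carrier G" "h \<in> carrier G"
      and x: "?x g = 1" "?x (g \<otimes> t) = 2" "?x (g \<otimes> h) = 3" "?x (g \<otimes> (t \<otimes> h)) = 4" for g t h
  proof -
    have g: "g = p"
      using x(1) \<open>g \<in> carrier G\<close> by (auto simp: mimic_config_def split: if_splits)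
    have gt: "g \<otimes> t = \<tau> \<otimes> p"
      using x(2) that(1,2) by (auto simp: mimic_config_def split: if_splits)
    have "g \<otimes> h \<in> P"
      using x(3) that(1,3) by (auto simp: mimic_config_def split: if_splits)
    have "g \<otimes> (t \<otimes> h) = \<tau> \<otimes> (g \<otimes> h)"
      using gt g that \<tau> by (metis m_assoc)
    moreover have "g \<otimes> (t \<otimes> h) \<in> (\<lambda>e. \<tau> \<otimes> e) ` (E - P)"
      using x(4) that(1,2,3) by (auto simp: mimic_config_def split: if_splits)
    ultimately obtain e where "e \<in> E - P" "\<tau> \<otimes> (g \<otimes> h) = \<tau> \<otimes> e"
      by auto
    then have "g \<otimes> h = e"
      using \<tau> E that by (auto simp: subset_iff)
    then show False
      using \<open>g \<otimes> h \<in> P\<close> \<open>e \<in> E - P\<close> by simp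
  qed
  ultimately show ?thesis
    unfolding mimic_shift_def by blast
qed

text \<open>Suppose that the shift of finite type \<open>Z\<close> covers the mimic shift, and choose a preimage for each of
the sets \<open>P\<close>. On a Foelner set \<open>F\<close> the boundary is so small that there are fewer possible boundary
values than subsets of the interior \<open>E\<close>, so two preimages agree on the boundary and can be spliced.
The image of the result shows \<open>P\<close> on \<open>E\<close> next to the complement of a different set \<open>P'\<close> on \<open>\<tau>E\<close>.
One of the two sets is not contained in the other; taking it as \<open>P\<close> contradicts the mimic rule.\<close>

lemma mimic_shift_not_sofic:
  assumes "infinite (carrier G)" "amenable G"
  shows "\<not> sofic G {0..4} (mimic_shift G)"
proof
  assume "sofic G {0..4} (mimic_shift G)"
  then obtain B :: "nat set" and Z \<phi> where sft: "sft G B Z"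
    and cont: "continuous_map (subtopology (config_topology G B) Z)
                 (subtopology (config_topology G {0..4}) (mimic_shift G)) \<phi>"
    and onto: "\<phi> ` Z = mimic_shift G"
    and equiv: "\<forall>g\<in>carrier G. \<forall>z\<in>Z. \<phi> (shift G g z) = shift G g (\<phi> z)"
    unfolding sofic_def by blast
  have Z: "subshift G B Z" using sft by (simp add: sft_def)
  then have "finite B" by (simp add: subshift_def)
  have ZB: "Z \<subseteq> configs G B"
    using Z closedin_subset unfolding subshift_def by fastforce
  obtain D1 where D1: "finite D1" "D1 \<subseteq> carrier G"
      and glue: "\<forall>F. \<forall>z\<in>Z. \<forall>z'\<in>Z.
        (\<forall>f\<in>window_boundary G D1 F. z f = z' f) \<longrightarrow> spliced G F z z' \<in> Z"
    using sft_splice[OF sft] by (elim exE conjE)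
  obtain D2 where D2: "finite D2" "D2 \<subseteq> carrier G"
      and local: "\<forall>g\<in>carrier G. \<forall>z\<in>Z. \<forall>z'\<in>Z.
        (\<forall>d\<in>D2. z (g \<otimes> d) = z' (g \<otimes> d)) \<longrightarrow> \<phi> z g = \<phi> z' g"
    using factor_map_local[OF Z cont equiv] by (elim exE conjE)
  \<comment> \<open>The window serves both the forbidden patterns and the factor map. With \<open>\<one>\<close> in it, outside \<open>F\<close>
    the image of the spliced configuration agrees with that of the outer one.\<close>
  define D where "D = insert \<one> (D1 \<union> D2)"
  have D: "finite D" "D \<noteq> {}" "D \<subseteq> carrier G" "\<one> \<in> D" "D1 \<subseteq> D" "D2 \<subseteq> D"
    using D1 D2 by (auto simp: D_def)
  define b where "b = card B"
  \<comment> \<open>The factor \<open>Suc b\<close> leaves \<open>b * card bd < card E\<close> after removal of the boundary, which suffices since \<open>b < 2 ^ b\<close>.\<close>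
  obtain F where F: "finite F" "F \<subseteq> carrier G" "Suc b * card (window_boundary G D F) < card F"
    using amenable_small_window_boundary[OF assms(2) D(1-3), of "Suc b"] by blast
  define bd where "bd = window_boundary G D F"
  define E where "E = F - bd"
  have "bd \<subseteq> F" by (auto simp: bd_def window_boundary_def)
  then have bd: "finite bd" "bd \<subseteq> carrier G" "E \<subseteq> F" "E \<subseteq> carrier G"
    using F finite_subset by (auto simp: E_def)
  have cE: "b * card bd < card E"
    using F \<open>bd \<subseteq> F\<close> bd by (simp add: E_def card_Diff_subset bd_def[symmetric])
  obtain p where p: "p \<in> carrier G" "p \<notin> F"
    using assms(1) F(1) by (meson finite_subset subsetI)
  obtain \<tau> where \<tau>: "\<tau> \<in> carrier G" "\<forall>f\<in>insert p F. \<tau> \<otimes> f \<notin> insert p F"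
    using exists_displacement[OF assms(1), of "insert p F"] F p by auto
  let ?x = "mimic_config G p \<tau> E"
  have "\<exists>z. z \<in> Z \<and> \<phi> z = ?x P" for P
  proof -
    have "?x P \<in> mimic_shift G"
      by (rule mimic_config_in_mimic_shift[OF p(1) \<tau>(1) bd(4)])
    then show ?thesis
      unfolding onto[symmetric] by (metis imageE)
  qed
  then obtain z where z: "\<And>P. z P \<in> Z" "\<And>P. \<phi> (z P) = ?x P"
    by metis
  have "\<not> inj_on (\<lambda>P. restrict (z P) bd) (Pow E)"
  proof (rule pigeonhole)
    have "finite E" using bd(3) F(1) finite_subset by blast
    have "(\<lambda>P. restrict (z P) bd) ` Pow E \<subseteq> bd \<rightarrow>\<^sub>E B"
    proof (rule image_subsetI)
      fix P
      have "z P \<in> configs G B" using z(1) ZB by blast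
      then show "restrict (z P) bd \<in> bd \<rightarrow>\<^sub>E B"
        using bd(2) by (auto simp: config_in_alphabet subset_iff)
    qed
    then have "card ((\<lambda>P. restrict (z P) bd) ` Pow E) \<le> card (bd \<rightarrow>\<^sub>E B)"
      using bd(1) \<open>finite B\<close> by (intro card_mono finite_PiE) auto
    also have "\<dots> = b ^ card bd"
      using bd(1) by (simp add: card_PiE b_def)
    also have "\<dots> \<le> (2 ^ b) ^ card bd"
      by (intro power_mono) (auto intro: less_imp_le)
    also have "\<dots> < 2 ^ card E"
      using cE by (simp add: power_mult[symmetric])
    also have "\<dots> = card (Pow E)"
      using \<open>finite E\<close> by (simp add: card_Pow)
    finally show "card ((\<lambda>P. restrict (z P) bd) ` Pow E) < card (Pow E)" .
  qed
  then obtain P P' where "P \<subseteq> E" "P' \<subseteq> E" "restrict (z P) bd = restrict (z P') bd" "\<not> P \<subseteq> P'"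
    unfolding inj_on_def by (metis PowD subset_antisym)
  then obtain f where f: "f \<in> P" "f \<notin> P'" and P: "P \<subseteq> E" "P' \<subseteq> E"
      and agree: "\<forall>f\<in>bd. z P f = z P' f"
    by (metis restrict_apply' subsetI)
  define y where "y = spliced G F (z P) (z P')"
  have "\<forall>f\<in>window_boundary G D1 F. z P f = z P' f"
    using agree window_boundary_mono[OF D(5), of F] unfolding bd_def by blast
  then have "y \<in> Z"
    unfolding y_def using glue z(1)[of P] z(1)[of P'] by blast
  note window = spliced_window[OF agree[unfolded bd_def] _ D(3), folded y_def]
  have inside: "\<phi> y g = ?x P g" if "g \<in> E" for g
  proof -
    have g: "g \<in> F" "g \<in> carrier G" using that bd by auto
    have "g \<otimes> d \<in> F" if "d \<in> D" for d
    proof (rule ccontr)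
      assume "g \<otimes> d \<notin> F"
      moreover have "g = g \<otimes> \<one>" using g by simp
      ultimately have "g \<in> bd"
        unfolding bd_def window_boundary_def using g D(4) that by blast
      then show False using \<open>g \<in> E\<close> by (simp add: E_def)
    qed
    then have "\<phi> y g = \<phi> (z P) g"
      using window(1)[of g] g D(6) \<open>y \<in> Z\<close> z(1)
      by (intro local[rule_format]) auto
    then show ?thesis using z(2) by simp
  qed
  have outside: "\<phi> y g = ?x P' g" if "g \<in> carrier G" "g \<notin> F" for g
  proof -
    have "g \<otimes> \<one> \<notin> F" using that by simp
    then have "\<not> (\<forall>d\<in>D. g \<otimes> d \<in> F)" using D(4) by blast
    then have "\<phi> y g = \<phi> (z P') g"
      using window(2)[of g] that D(6) \<open>y \<in> Z\<close> z(1)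
      by (intro local[rule_format]) auto
    then show ?thesis using z(2) by simp
  qed
  have fE: "f \<in> E" "f \<in> F" "f \<in> carrier G" using f P bd by auto
  have disj: "\<tau> \<otimes> p \<noteq> p" "\<tau> \<otimes> p \<notin> F" "\<tau> \<otimes> f \<notin> F" "\<tau> \<otimes> f \<noteq> p"
    using \<tau>(2) fE by auto
  have "\<phi> y p = 1"
    using outside[of p] p by (simp add: mimic_config_def)
  moreover have "\<phi> y (\<tau> \<otimes> p) = 2"
    using outside[of "\<tau> \<otimes> p"] disj p \<tau>(1) by (simp add: mimic_config_def)
  moreover have "\<phi> y f = 3"
    using inside[OF fE(1)] f disj fE p by (auto simp: mimic_config_def)
  moreover have "\<phi> y (\<tau> \<otimes> f) = 4"
  proof -
    have "\<tau> \<otimes> f \<noteq> \<tau> \<otimes> p" "\<tau> \<otimes> f \<notin> P'"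
      using fE p \<tau>(1) disj P bd by auto
    then show ?thesis
      using outside[of "\<tau> \<otimes> f"] disj fE \<tau>(1) f by (simp add: mimic_config_def)
  qed
  \<comment> \<open>the mimic rule with \<open>g = p\<close>, \<open>t = inv p \<tau> p\<close> and \<open>h = inv p f\<close>\<close>
  moreover have "p \<otimes> (inv p \<otimes> \<tau> \<otimes> p) = \<tau> \<otimes> p" "p \<otimes> (inv p \<otimes> f) = f"
      "p \<otimes> ((inv p \<otimes> \<tau> \<otimes> p) \<otimes> (inv p \<otimes> f)) = \<tau> \<otimes> f"
    using p \<tau>(1) fE by (simp_all add: m_assoc[symmetric]) (simp_all add: m_assoc)
  moreover have "inv p \<otimes> \<tau> \<otimes> p \<in> carrier G" "inv p \<otimes> f \<in> carrier G"
    using p \<tau>(1) fE by simp_all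
  moreover have "\<phi> y \<in> mimic_shift G"
    using \<open>y \<in> Z\<close> onto by blast
  ultimately show False
    using p(1) unfolding mimic_shift_def by fastforce
qed

end

theorem theorem2p16:
  fixes G :: "('g, 'm) monoid_scheme" and S :: "'g set"
  assumes "group G"
    and "infinite (carrier G)"
    and "finite S" and "S \<subseteq> carrier G"
    and "\<one>\<^bsub>G\<^esub> \<in> S" and "\<forall>s\<in>S. inv\<^bsub>G\<^esub> s \<in> S"
    and "generate G S = carrier G"
    and "amenable G"
  shows "\<exists>(A :: nat set) (X :: ('g \<Rightarrow> nat) set).
           finite A \<and> effectively_closed G S A X \<and> \<not> sofic G A X"
  using group.effectively_closed_mimic_shift[OF assms(1,3-7)] group.mimic_shift_not_sofic[OF assms(1,2,8)]
  by (intro exI[of _ "{0..4}"] exI[of _ "mimic_shift G"]) simp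

end
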